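(* Let $\mathfrak{g}$ be a Fricke Lie algebra equipped with a level $N$ q-compatibility groupoid for some $N\in\mathbb{Z}_{\ge1}$. For each $n\in\mathbb{Z}$, let $c(n)$ denote the multiplicity of the simple root of degree $(1,n)$ in $\mathfrak{g}$. Then the group of homogeneous automorphisms of $\mathfrak{g}$ is $$\prod_{n=-1}^\infty GL_{c(n)}(\mathbb{C}).$$
   Context: Borcherds-Kac-Moody algebras. A generalized Cartan matrix is a real matrix $A=(a_{i,j})_{i,j\in I}$, $I$ countable, that is symmetrizable (there is a diagonal matrix $Q$ with positive real diagonal entries such that $QA$ is symmetric), with $a_{i,j}\le 0$ for $i\ne j$, and such that if $a_{i,i}>0$ then $a_{i,i}=2$ and $a_{i,j}\in\mathbb{Z}$ for all $j$. $\mathfrak{g}(A)$ is the complex Lie algebra generated by $\{h_i,e_i,f_i\}_{i\in I}$ with relations $[h_i,e_k]=a_{i,k}e_k$, $[h_i,f_k]=-a_{i,k}f_k$, $[e_i,f_j]=\delta_{i,j}h_i$; $\mathrm{ad}(e_i)^{1-a_{i,j}}(e_j)=\mathrm{ad}(f_i)^{1-a_{i,j}}(f_j)=0$ if $a_{i,i}>0$, $i\neq j$; $[e_i,e_j]=[f_i,f_j]=0$ if $a_{i,j}=0$. A Borcherds-Kac-Moody algebra is a Lie algebra of the form $(\mathfrak{g}(A)/C).D$ with $C$ a central ideal and $D$ a commutative Lie algebra of outer derivations. Fricke Lie algebras. A Lie algebra is Fricke if it is Borcherds-Kac-Moody of rank 2 (Cartan subalgebra 2-dimensional), has exactly one real (positive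 norm) simple root, has no norm zero simple roots, admits a norm zero Weyl vector $\rho$ (all simple roots $r$ satisfy $(r,\rho)=-r^2$, with the convention $r^2=\frac12(r,r)$), and for any $B>0$ has only finitely many simple roots $r$ (counted with multiplicity) with $(r,r)>-B$. A Fricke Lie algebra has a $\mathbb{Z}\times\mathbb{Z}$-grading $\mathfrak{g}=\bigoplus\mathfrak{g}_{m,n}$ by roots (with $\mathfrak{g}_{0,0}$ the Cartan subalgebra) in which the real simple root has degree $(1,-1)$ and the imaginary simple roots have degrees $(1,n)$, $n\ge1$, with finite multiplicity. A homogeneous automorphism is a Lie algebra automorphism that preserves each graded piece. Level $N$ q-compatibility groupoid on $\mathfrak{g}$: a collection of complex vector spaces $\{V^{a,b}_n\}_{a,b\in\mathbb{Z}/N\mathbb{Z},\,n\in\mathbb{Z}}$ together with isomorphisms $\phi_{r,s}:\mathfrak{g}_{r,s}\to V^{r,s}_{rs}$ for all $(r,s)\ne(0,0)$ (superscripts read modulo $N$); equivalently, a system of isomorphisms identifying all root spaces whose bidegrees have the same product and the same residue class modulo $N$. $GL_0(\mathbb{C})$ is the trivial group. *)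

theory Defs
  imports
    "Jordan_Normal_Form.Matrix"
    "HOL-Algebra.Product_Groups"
    "HOL-Library.Countable"
begin

section \<open>Complex vector spaces and complex Lie algebras\<close>

class complex_vector = ab_group_add +
  fixes scaleC :: "complex \<Rightarrow> 'a \<Rightarrow> 'a"  (infixr \<open>*\<^sub>C\<close> 75)
  assumes scaleC_add_right: "a *\<^sub>C (x + y) = a *\<^sub>C x + a *\<^sub>C y"
    and scaleC_add_left: "(a + b) *\<^sub>C x = a *\<^sub>C x + b *\<^sub>C x"
    and scaleC_scaleC: "a *\<^sub>C b *\<^sub>C x = (a * b) *\<^sub>C x"
    and scaleC_one: "1 *\<^sub>C x = x"

global_interpretation cvec: vector_space "scaleC :: complex \<Rightarrow> 'a \<Rightarrow> 'a::complex_vector"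
  by standard (simp_all add: scaleC_add_right scaleC_add_left scaleC_scaleC scaleC_one)

class complex_lie_algebra = complex_vector +
  fixes lie_bracket :: "'a \<Rightarrow> 'a \<Rightarrow> 'a"  (\<open>\<^bold>[_,/ _\<^bold>]\<close>)
  assumes lie_add_left: "\<^bold>[x + y, z\<^bold>] = \<^bold>[x, z\<^bold>] + \<^bold>[y, z\<^bold>]"
    and lie_add_right: "\<^bold>[x, y + z\<^bold>] = \<^bold>[x, y\<^bold>] + \<^bold>[x, z\<^bold>]"
    and lie_scale_left: "\<^bold>[c *\<^sub>C x, y\<^bold>] = c *\<^sub>C \<^bold>[x, y\<^bold>]"
    and lie_scale_right: "\<^bold>[x, c *\<^sub>C y\<^bold>] = c *\<^sub>C \<^bold>[x, y\<^bold>]"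
    and lie_self: "\<^bold>[x, x\<^bold>] = 0"
    and lie_jacobi: "\<^bold>[x, \<^bold>[y, z\<^bold>]\<^bold>] + \<^bold>[y, \<^bold>[z, x\<^bold>]\<^bold>] + \<^bold>[z, \<^bold>[x, y\<^bold>]\<^bold>] = 0"

definition lie_hom :: "('a::complex_lie_algebra \<Rightarrow> 'b::complex_lie_algebra) \<Rightarrow> bool" where
  "lie_hom f \<longleftrightarrow> Vector_Spaces.linear scaleC scaleC f \<and> (\<forall>x y. f \<^bold>[x, y\<^bold>] = \<^bold>[f x, f y\<^bold>])"

definition lie_ideal :: "'a::complex_lie_algebra set \<Rightarrow> bool" where
  "lie_ideal J \<longleftrightarrow> cvec.subspace J \<and> (\<forall>x. \<forall>y\<in>J. \<^bold>[x, y\<^bold>] \<in> J)"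

definition lie_ideal_generated :: "'a::complex_lie_algebra set \<Rightarrow> 'a set" where
  "lie_ideal_generated R = \<Inter>{J. lie_ideal J \<and> R \<subseteq> J}"


section \<open>The free complex Lie algebra on a set of generators\<close>

datatype 'x lie_term =
    TGen 'x
  | TZero
  | TAdd "'x lie_term" "'x lie_term"
  | TNeg "'x lie_term"
  | TScale complex "'x lie_term"
  | TBracket "'x lie_term" "'x lie_term"

inductive lie_term_eq :: "'x lie_term \<Rightarrow> 'x lie_term \<Rightarrow> bool" where
  refl: "lie_term_eq s s"
| sym: "lie_term_eq s t \<Longrightarrow> lie_term_eq t s"
| trans: "lie_term_eq s t \<Longrightarrow> lie_term_eq t u \<Longrightarrow> lie_term_eq s u"
| cong_add: "lie_term_eq s s' \<Longrightarrow> lie_term_eq t t' \<Longrightarrow> lie_term_eq (TAdd s t) (TAdd s' t')"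
| cong_neg: "lie_term_eq s s' \<Longrightarrow> lie_term_eq (TNeg s) (TNeg s')"
| cong_scale: "lie_term_eq s s' \<Longrightarrow> lie_term_eq (TScale c s) (TScale c s')"
| cong_bracket:
    "lie_term_eq s s' \<Longrightarrow> lie_term_eq t t' \<Longrightarrow> lie_term_eq (TBracket s t) (TBracket s' t')"
| add_assoc: "lie_term_eq (TAdd (TAdd s t) u) (TAdd s (TAdd t u))"
| add_comm: "lie_term_eq (TAdd s t) (TAdd t s)"
| add_zero: "lie_term_eq (TAdd TZero s) s"
| add_neg: "lie_term_eq (TAdd (TNeg s) s) TZero"
| scale_add_right: "lie_term_eq (TScale c (TAdd s t)) (TAdd (TScale c s) (TScale c t))"
| scale_add_left: "lie_term_eq (TScale (c + d) s) (TAdd (TScale c s) (TScale d s))"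
| scale_scale: "lie_term_eq (TScale c (TScale d s)) (TScale (c * d) s)"
| scale_one: "lie_term_eq (TScale 1 s) s"
| br_add_left: "lie_term_eq (TBracket (TAdd s t) u) (TAdd (TBracket s u) (TBracket t u))"
| br_add_right: "lie_term_eq (TBracket s (TAdd t u)) (TAdd (TBracket s t) (TBracket s u))"
| br_scale_left: "lie_term_eq (TBracket (TScale c s) t) (TScale c (TBracket s t))"
| br_scale_right: "lie_term_eq (TBracket s (TScale c t)) (TScale c (TBracket s t))"
| br_self: "lie_term_eq (TBracket s s) TZero"
| br_jacobi:
    "lie_term_eq
       (TAdd (TAdd (TBracket s (TBracket t u)) (TBracket t (TBracket u s)))
          (TBracket u (TBracket s t)))
       TZero"

quotient_type 'x free_lie = "'x lie_term" / lie_term_eq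
  by (intro equivpI reflpI sympI transpI)
     (auto intro: lie_term_eq.refl lie_term_eq.sym lie_term_eq.trans)

lift_definition free_gen :: "'x \<Rightarrow> 'x free_lie" is TGen .

instantiation free_lie :: (type) complex_lie_algebra
begin

lift_definition zero_free_lie :: "'a free_lie" is TZero .
lift_definition plus_free_lie :: "'a free_lie \<Rightarrow> 'a free_lie \<Rightarrow> 'a free_lie" is TAdd
  by (rule lie_term_eq.cong_add)
lift_definition uminus_free_lie :: "'a free_lie \<Rightarrow> 'a free_lie" is TNeg
  by (rule lie_term_eq.cong_neg)
lift_definition minus_free_lie :: "'a free_lie \<Rightarrow> 'a free_lie \<Rightarrow> 'a free_lie"
  is "\<lambda>s t. TAdd s (TNeg t)"
  by (intro lie_term_eq.cong_add lie_term_eq.cong_neg)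
lift_definition scaleC_free_lie :: "complex \<Rightarrow> 'a free_lie \<Rightarrow> 'a free_lie" is TScale
  by (rule lie_term_eq.cong_scale)
lift_definition lie_bracket_free_lie :: "'a free_lie \<Rightarrow> 'a free_lie \<Rightarrow> 'a free_lie" is TBracket
  by (rule lie_term_eq.cong_bracket)

instance
  by standard
    (transfer, rule lie_term_eq.refl lie_term_eq.add_assoc lie_term_eq.add_comm
      lie_term_eq.add_zero lie_term_eq.add_neg lie_term_eq.scale_add_right
      lie_term_eq.scale_add_left lie_term_eq.scale_scale lie_term_eq.scale_one
      lie_term_eq.br_add_left lie_term_eq.br_add_right lie_term_eq.br_scale_left
      lie_term_eq.br_scale_right lie_term_eq.br_self lie_term_eq.br_jacobi)+

end

primrec lie_term_eval :: "('x \<Rightarrow> 'a::complex_lie_algebra) \<Rightarrow> 'x lie_term \<Rightarrow> 'a" where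
  "lie_term_eval v (TGen x) = v x"
| "lie_term_eval v TZero = 0"
| "lie_term_eval v (TAdd s t) = lie_term_eval v s + lie_term_eval v t"
| "lie_term_eval v (TNeg s) = - lie_term_eval v s"
| "lie_term_eval v (TScale c s) = c *\<^sub>C lie_term_eval v s"
| "lie_term_eval v (TBracket s t) = \<^bold>[lie_term_eval v s, lie_term_eval v t\<^bold>]"

lift_definition free_lie_extend :: "('x \<Rightarrow> 'a::complex_lie_algebra) \<Rightarrow> 'x free_lie \<Rightarrow> 'a"
  is lie_term_eval
proof -
  fix v :: "'x \<Rightarrow> 'a" and s t :: "'x lie_term"
  assume "lie_term_eq s t"
  then show "lie_term_eval v s = lie_term_eval v t"
    by induction
       (simp_all add: add.assoc add.commute scaleC_add_right scaleC_add_left scaleC_scaleC scaleC_one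
          lie_add_left lie_add_right lie_scale_left lie_scale_right lie_self
          lie_jacobi[unfolded add.assoc])
qed

lemma free_lie_universal:
  fixes v :: "'x \<Rightarrow> 'a::complex_lie_algebra"
  shows "\<exists>!f. lie_hom f \<and> (\<forall>x. f (free_gen x) = v x)"
proof (rule ex1I)
  have "Vector_Spaces.linear scaleC scaleC (free_lie_extend v)"
    by unfold_locales (transfer, simp)+
  moreover have "free_lie_extend v \<^bold>[x, y\<^bold>] = \<^bold>[free_lie_extend v x, free_lie_extend v y\<^bold>]" for x y
    by transfer simp
  moreover have "free_lie_extend v (free_gen x) = v x" for x
    by transfer simp
  ultimately show "lie_hom (free_lie_extend v) \<and> (\<forall>x. free_lie_extend v (free_gen x) = v x)"
    by (simp add: lie_hom_def)
next
  fix f :: "'x free_lie \<Rightarrow> 'a"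
  assume f: "lie_hom f \<and> (\<forall>x. f (free_gen x) = v x)"
  then interpret f: Vector_Spaces.linear scaleC scaleC f
    by (simp add: lie_hom_def)
  have "f (abs_free_lie t) = lie_term_eval v t" for t
  proof (induction t)
    case (TGen x)
    then show ?case using f by (simp add: free_gen.abs_eq[symmetric])
  next
    case TZero
    then show ?case using f.zero by (simp add: zero_free_lie.abs_eq)
  next
    case (TAdd s t)
    then show ?case using f.add by (simp flip: plus_free_lie.abs_eq)
  next
    case (TNeg s)
    then show ?case using f.neg by (simp flip: uminus_free_lie.abs_eq)
  next
    case (TScale c s)
    then show ?case using f.scale by (simp flip: scaleC_free_lie.abs_eq)
  next
    case (TBracket s t)
    then show ?case using f by (simp add: lie_hom_def flip: lie_bracket_free_lie.abs_eq)
  qed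
  then have "f x = free_lie_extend v x" for x
    by (induct x rule: free_lie.abs_induct) (simp add: free_lie_extend.abs_eq)
  then show "f = free_lie_extend v"
    by (rule ext)
qed


section \<open>Borcherds-Kac-Moody algebras\<close>

definition symmetrizer :: "('i \<Rightarrow> 'i \<Rightarrow> real) \<Rightarrow> ('i \<Rightarrow> real) \<Rightarrow> bool" where
  "symmetrizer A q \<longleftrightarrow> (\<forall>i. 0 < q i) \<and> (\<forall>i j. q i * A i j = q j * A j i)"

text \<open>The countable index set is the whole type \<open>'i\<close>.\<close>

definition generalized_cartan_matrix :: "('i::countable \<Rightarrow> 'i \<Rightarrow> real) \<Rightarrow> bool" where
  "generalized_cartan_matrix A \<longleftrightarrow>
     (\<exists>q. symmetrizer A q) \<and>
     (\<forall>i j. i \<noteq> j \<longrightarrow> A i j \<le> 0) \<and>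
     (\<forall>i. 0 < A i i \<longrightarrow> A i i = 2 \<and> (\<forall>j. A i j \<in> \<int>))"

datatype 'i bkm_gen = GenH 'i | GenE 'i | GenF 'i

abbreviation free_h :: "'i \<Rightarrow> 'i bkm_gen free_lie" where "free_h i \<equiv> free_gen (GenH i)"
abbreviation free_e :: "'i \<Rightarrow> 'i bkm_gen free_lie" where "free_e i \<equiv> free_gen (GenE i)"
abbreviation free_f :: "'i \<Rightarrow> 'i bkm_gen free_lie" where "free_f i \<equiv> free_gen (GenF i)"

text \<open>In the Serre relators the exponent \<open>1 - A i j\<close> is a positive integer for a generalized
  Cartan matrix, so \<open>nat\<close> and the floor only change its type.\<close>

inductive_set bkm_relators :: "('i \<Rightarrow> 'i \<Rightarrow> real) \<Rightarrow> 'i bkm_gen free_lie set"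
  for A :: "'i \<Rightarrow> 'i \<Rightarrow> real" where
  he: "\<^bold>[free_h i, free_e k\<^bold>] - complex_of_real (A i k) *\<^sub>C free_e k \<in> bkm_relators A"
| hf: "\<^bold>[free_h i, free_f k\<^bold>] + complex_of_real (A i k) *\<^sub>C free_f k \<in> bkm_relators A"
| ef_same: "\<^bold>[free_e i, free_f i\<^bold>] - free_h i \<in> bkm_relators A"
| ef_diff: "i \<noteq> j \<Longrightarrow> \<^bold>[free_e i, free_f j\<^bold>] \<in> bkm_relators A"
| serre_e: "0 < A i i \<Longrightarrow> i \<noteq> j \<Longrightarrow>
    (lie_bracket (free_e i) ^^ nat \<lfloor>1 - A i j\<rfloor>) (free_e j) \<in> bkm_relators A"
| serre_f: "0 < A i i \<Longrightarrow> i \<noteq> j \<Longrightarrow>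
    (lie_bracket (free_f i) ^^ nat \<lfloor>1 - A i j\<rfloor>) (free_f j) \<in> bkm_relators A"
| ee: "A i j = 0 \<Longrightarrow> \<^bold>[free_e i, free_e j\<^bold>] \<in> bkm_relators A"
| ff: "A i j = 0 \<Longrightarrow> \<^bold>[free_f i, free_f j\<^bold>] \<in> bkm_relators A"

text \<open>\<open>\<gg>(A)\<close> is the quotient of the free Lie algebra by this ideal.\<close>

definition bkm_ideal :: "('i \<Rightarrow> 'i \<Rightarrow> real) \<Rightarrow> 'i bkm_gen free_lie set" where
  "bkm_ideal A = lie_ideal_generated (bkm_relators A)"

text \<open>
  The Lie algebra \<open>\<gg>\<close> (the whole type \<open>'g\<close>) is of the form \<open>(\<gg>(A)/C).D\<close>.
  The homomorphism \<open>\<pi>\<close> is the composite of the projection of the free Lie algebra onto \<open>\<gg>(A)\<close>,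
  the projection \<open>\<gg>(A) \<rightarrow> \<gg>(A)/C\<close> and the inclusion of \<open>\<gg>(A)/C\<close> in \<open>\<gg>\<close>;
  \<open>C\<close> is the image of the kernel of \<open>\<pi>\<close> in \<open>\<gg>(A)\<close>, so that \<open>C\<close> is central in \<open>\<gg>(A)\<close> iff all brackets
  with elements of that kernel lie in \<^term>\<open>bkm_ideal A\<close>.
  The last assumption says that the derivation of \<open>\<gg>(A)/C\<close> given by a nonzero element of \<open>D\<close>
  is not inner.
\<close>

locale bkm_algebra =
  fixes A :: "'i::countable \<Rightarrow> 'i \<Rightarrow> real"
    and \<pi> :: "'i bkm_gen free_lie \<Rightarrow> 'g::complex_lie_algebra"
    and D :: "'g set"
  assumes cartan_matrix: "generalized_cartan_matrix A"
    and hom: "lie_hom \<pi>"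
    and kernel: "x \<in> bkm_ideal A \<Longrightarrow> \<pi> x = 0"
    and central: "\<pi> x = 0 \<Longrightarrow> \<^bold>[x, y\<^bold>] \<in> bkm_ideal A"
    and image_ideal: "lie_ideal (range \<pi>)"
    and D_subspace: "cvec.subspace D"
    and D_commutative: "d \<in> D \<Longrightarrow> d' \<in> D \<Longrightarrow> \<^bold>[d, d'\<^bold>] = 0"
    and D_int: "range \<pi> \<inter> D = {0}"
    and D_sum: "\<exists>k\<in>range \<pi>. \<exists>d\<in>D. z = k + d"
    and D_outer: "d \<in> D \<Longrightarrow> k \<in> range \<pi> \<Longrightarrow> (\<And>x. x \<in> range \<pi> \<Longrightarrow> \<^bold>[d, x\<^bold>] = \<^bold>[k, x\<^bold>]) \<Longrightarrow> d = 0"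
begin

definition gen_h :: "'i \<Rightarrow> 'g" where "gen_h i = \<pi> (free_h i)"
definition gen_e :: "'i \<Rightarrow> 'g" where "gen_e i = \<pi> (free_e i)"
definition gen_f :: "'i \<Rightarrow> 'g" where "gen_f i = \<pi> (free_f i)"

definition cartan :: "'g set" where
  "cartan = cvec.span (range gen_h \<union> D)"

end


text \<open>
  \<open>Q = diag q\<close> symmetrizes \<open>A\<close>, and \<open>B\<close> is the corresponding bilinear form on the Cartan subalgebra;
  it is only specified there. By means of \<open>B\<close>, roots are regarded as elements of the Cartan
  subalgebra: \<open>r\<close> stands for the linear functional \<open>B r\<close>. The simple root of index \<open>i\<close> is then
  \<open>q i *\<^sub>C gen_h i\<close>, and the form on simple roots is given by the matrix \<open>QA\<close>.
  Simple roots with multiplicity are the indices of type \<open>'i\<close>.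
\<close>

locale bkm_algebra_form = bkm_algebra A \<pi> D
  for A :: "'i::countable \<Rightarrow> 'i \<Rightarrow> real"
    and \<pi> :: "'i bkm_gen free_lie \<Rightarrow> 'g::complex_lie_algebra"
    and D :: "'g set" +
  fixes q :: "'i \<Rightarrow> real"
    and B :: "'g \<Rightarrow> 'g \<Rightarrow> complex"
  assumes q_symmetrizer: "symmetrizer A q"
    and B_sym: "s \<in> cartan \<Longrightarrow> t \<in> cartan \<Longrightarrow> B s t = B t s"
    and B_add: "s \<in> cartan \<Longrightarrow> t \<in> cartan \<Longrightarrow> u \<in> cartan \<Longrightarrow> B (s + t) u = B s u + B t u"
    and B_scale: "s \<in> cartan \<Longrightarrow> t \<in> cartan \<Longrightarrow> B (c *\<^sub>C s) t = c * B s t"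
    and B_simple: "B (complex_of_real (q i) *\<^sub>C gen_h i) (complex_of_real (q j) *\<^sub>C gen_h j)
      = complex_of_real (q i * A i j)"
    and weight_e: "t \<in> cartan \<Longrightarrow>
      \<^bold>[t, gen_e i\<^bold>] = B (complex_of_real (q i) *\<^sub>C gen_h i) t *\<^sub>C gen_e i"
    and weight_f: "t \<in> cartan \<Longrightarrow>
      \<^bold>[t, gen_f i\<^bold>] = - B (complex_of_real (q i) *\<^sub>C gen_h i) t *\<^sub>C gen_f i"
begin

definition simple_root :: "'i \<Rightarrow> 'g" where
  "simple_root i = complex_of_real (q i) *\<^sub>C gen_h i"

definition simple_root_norm :: "'i \<Rightarrow> real" where
  "simple_root_norm i = q i * A i i"

definition root_space :: "'g \<Rightarrow> 'g set" where
  "root_space r = {x. \<forall>t\<in>cartan. \<^bold>[t, x\<^bold>] = B r t *\<^sub>C x}"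

text \<open>The factor 1/2 comes from the convention \<open>r\<^sup>2 = (r, r)/2\<close> in \<open>(r, \<rho>) = - r\<^sup>2\<close>.\<close>

definition weyl_vector :: "'g \<Rightarrow> bool" where
  "weyl_vector \<rho> \<longleftrightarrow> \<rho> \<in> cartan \<and>
     (\<forall>i. B (simple_root i) \<rho> = - B (simple_root i) (simple_root i) / 2)"

end


section \<open>Fricke Lie algebras\<close>

locale fricke_lie_algebra = bkm_algebra_form A \<pi> D q B
  for A :: "'i::countable \<Rightarrow> 'i \<Rightarrow> real"
    and \<pi> :: "'i bkm_gen free_lie \<Rightarrow> 'g::complex_lie_algebra"
    and D :: "'g set"
    and q :: "'i \<Rightarrow> real"
    and B :: "'g \<Rightarrow> 'g \<Rightarrow> complex" +
  assumes rank: "cvec.dim cartan = 2"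
    and one_real: "\<exists>!i. simple_root_norm i > 0"
    and no_norm_zero: "simple_root_norm i \<noteq> 0"
    and norm_zero_weyl_vector: "\<exists>\<rho>. weyl_vector \<rho> \<and> B \<rho> \<rho> = 0"
    and finitely_many: "b > 0 \<Longrightarrow> finite {i. simple_root_norm i > - b}"

text \<open>
  \<open>\<gg>\<close> is the direct sum of the subspaces \<open>G m n\<close>. The grading is by roots: degree \<open>(m, n)\<close>
  corresponds to the root \<open>m u + n v\<close>, and \<open>G m n\<close> is the space of that root.
  The degree of the simple root of index \<open>i\<close> is \<open>deg i\<close>.
\<close>

locale graded_fricke_lie_algebra = fricke_lie_algebra A \<pi> D q B
  for A :: "'i::countable \<Rightarrow> 'i \<Rightarrow> real"
    and \<pi> :: "'i bkm_gen free_lie \<Rightarrow> 'g::complex_lie_algebra"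
    and D :: "'g set"
    and q :: "'i \<Rightarrow> real"
    and B :: "'g \<Rightarrow> 'g \<Rightarrow> complex" +
  fixes G :: "int \<Rightarrow> int \<Rightarrow> 'g set"
    and deg :: "'i \<Rightarrow> int \<times> int"
  assumes G_subspace: "cvec.subspace (G m n)"
    and G_span: "cvec.span (\<Union>m n. G m n) = UNIV"
    and G_independent: "finite S \<Longrightarrow> (\<And>m n. (m, n) \<in> S \<Longrightarrow> z (m, n) \<in> G m n) \<Longrightarrow>
      (\<Sum>p\<in>S. z p) = 0 \<Longrightarrow> p \<in> S \<Longrightarrow> z p = 0"
    and G_bracket: "x \<in> G k l \<Longrightarrow> y \<in> G m n \<Longrightarrow> \<^bold>[x, y\<^bold>] \<in> G (k + m) (l + n)"
    and G_zero: "G 0 0 = cartan"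
    and G_roots: "\<exists>u\<in>cartan. \<exists>v\<in>cartan.
      (\<forall>m n. G m n = root_space (of_int m *\<^sub>C u + of_int n *\<^sub>C v)) \<and>
      (\<forall>i. simple_root i = of_int (fst (deg i)) *\<^sub>C u + of_int (snd (deg i)) *\<^sub>C v)"
    and deg_real: "simple_root_norm i > 0 \<Longrightarrow> deg i = (1, - 1)"
    and deg_imaginary: "simple_root_norm i < 0 \<Longrightarrow> \<exists>n\<ge>1. deg i = (1, n)"
    and finite_multiplicity: "finite {i. deg i = (1, n)}"

definition simple_root_mult :: "('i \<Rightarrow> int \<times> int) \<Rightarrow> int \<Rightarrow> nat" where
  "simple_root_mult deg n = card {i. deg i = (1, n)}"

definition homogeneous_aut_group ::
    "(int \<Rightarrow> int \<Rightarrow> 'g::complex_lie_algebra set) \<Rightarrow> ('g \<Rightarrow> 'g) monoid" where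
  "homogeneous_aut_group G =
     \<lparr>carrier = {\<sigma>. lie_hom \<sigma> \<and> bij \<sigma> \<and> (\<forall>m n. \<sigma> ` G m n = G m n)},
      monoid.mult = (\<circ>),
      one = id\<rparr>"

text \<open>
  Elements of \<open>\<int>/N\<int>\<close> are represented by the integers in \<open>{0..<N}\<close>, and the spaces \<open>V a b n\<close>
  are realised as subspaces of one vector space, without any condition on their position in it.
\<close>

definition q_compatibility_groupoid ::
    "int \<Rightarrow> (int \<Rightarrow> int \<Rightarrow> 'g::complex_lie_algebra set) \<Rightarrow>
     (int \<Rightarrow> int \<Rightarrow> int \<Rightarrow> 'v::complex_vector set) \<Rightarrow> (int \<Rightarrow> int \<Rightarrow> 'g \<Rightarrow> 'v) \<Rightarrow> bool" where
  "q_compatibility_groupoid N G V \<phi> \<longleftrightarrow>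
     (\<forall>a\<in>{0..<N}. \<forall>b\<in>{0..<N}. \<forall>n. cvec.subspace (V a b n)) \<and>
     (\<forall>r s. (r, s) \<noteq> (0, 0) \<longrightarrow>
        bij_betw (\<phi> r s) (G r s) (V (r mod N) (s mod N) (r * s)) \<and>
        (\<forall>x\<in>G r s. \<forall>y\<in>G r s. \<phi> r s (x + y) = \<phi> r s x + \<phi> r s y) \<and>
        (\<forall>c. \<forall>x\<in>G r s. \<phi> r s (c *\<^sub>C x) = c *\<^sub>C \<phi> r s x))"

definition general_linear_group :: "nat \<Rightarrow> complex mat monoid" where
  "general_linear_group n = units_of (ring_mat TYPE(complex) n ())"

end

theory Submission
  imports Defs
begin

text \<open>
  A real simple root and an imaginary one span a nondegenerate plane, since their Gram determinant is
  negative. As the Cartan subalgebra is 2-dimensional, the form is nondegenerate on it, there are no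
  outer derivations, and the centre is trivial; moreover a homogeneous automorphism fixes the Cartan
  subalgebra pointwise. By the triangular decomposition the spaces of degree \<open>(1, n)\<close> and
  \<open>(-1, -n)\<close> are spanned by the generators \<open>e\<^sub>i\<close> and \<open>f\<^sub>i\<close> with \<open>i\<close> of degree \<open>(1, n)\<close>, and
  they are dual to each other through the bracket. Hence a homogeneous automorphism is determined by
  its matrices on the spaces of degree \<open>(1, n)\<close>. Conversely, let invertible matrices act on the
  \<open>e\<^sub>i\<close> and their inverse transposes, rescaled by the symmetrizer, on the \<open>f\<^sub>i\<close>. The defining
  relations are preserved, because \<open>q\<^sub>i a\<^sub>i\<^sub>j\<close> depends only on the degrees of \<open>i\<close> and \<open>j\<close> and the
  real simple root is alone in its degree.
\<close>

section \<open>Lie brackets and homomorphisms\<close>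

lemma lie_zero_left [simp]: "\<^bold>[0, x\<^bold>] = (0::'a::complex_lie_algebra)"
  using lie_add_left[of 0 0 x] by simp

lemma lie_zero_right [simp]: "\<^bold>[x, 0\<^bold>] = (0::'a::complex_lie_algebra)"
  using lie_add_right[of x 0 0] by simp

lemma lie_swap: "\<^bold>[x, y\<^bold>] = - \<^bold>[y, x :: 'a::complex_lie_algebra\<^bold>]"
proof -
  have "\<^bold>[x + y, x\<^bold>] + \<^bold>[x + y, y\<^bold>] = 0"
    by (simp add: lie_self flip: lie_add_right)
  then show ?thesis
    by (simp add: lie_add_left lie_self eq_neg_iff_add_eq_0 add.commute)
qed

lemma lie_minus_right: "\<^bold>[x, - y\<^bold>] = - \<^bold>[x, y :: 'a::complex_lie_algebra\<^bold>]"
  using lie_add_right[of x y "- y"] by (simp add: eq_neg_iff_add_eq_0 add.commute)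

lemma lie_minus_left: "\<^bold>[- x, y\<^bold>] = - \<^bold>[x, y :: 'a::complex_lie_algebra\<^bold>]"
  using lie_add_left[of x "- x" y] by (simp add: eq_neg_iff_add_eq_0 add.commute)

lemma lie_diff_right: "\<^bold>[x, y - z\<^bold>] = \<^bold>[x, y\<^bold>] - \<^bold>[x, z :: 'a::complex_lie_algebra\<^bold>]"
  using lie_add_right[of x y "- z"] by (simp add: lie_minus_right)

lemma lie_diff_left: "\<^bold>[x - y, z\<^bold>] = \<^bold>[x, z\<^bold>] - \<^bold>[y, z :: 'a::complex_lie_algebra\<^bold>]"
  using lie_add_left[of x "- y" z] by (simp add: lie_minus_left)

lemma lie_sum_right: "\<^bold>[x, \<Sum>i\<in>S. g i\<^bold>] = (\<Sum>i\<in>S. \<^bold>[x, g i :: 'a::complex_lie_algebra\<^bold>])"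
  by (induction S rule: infinite_finite_induct) (simp_all add: lie_add_right)

lemma lie_sum_left: "\<^bold>[\<Sum>i\<in>S. g i, x\<^bold>] = (\<Sum>i\<in>S. \<^bold>[g i, x :: 'a::complex_lie_algebra\<^bold>])"
  by (induction S rule: infinite_finite_induct) (simp_all add: lie_add_left)

lemma lie_derivation: "\<^bold>[x, \<^bold>[y, z\<^bold>]\<^bold>] = \<^bold>[\<^bold>[x, y\<^bold>], z\<^bold>] + \<^bold>[y, \<^bold>[x, z :: 'a::complex_lie_algebra\<^bold>]\<^bold>]"
proof -
  have "\<^bold>[\<^bold>[x, y\<^bold>], z\<^bold>] = - \<^bold>[z, \<^bold>[x, y\<^bold>]\<^bold>]" and "\<^bold>[y, \<^bold>[x, z\<^bold>]\<^bold>] = - \<^bold>[y, \<^bold>[z, x\<^bold>]\<^bold>]"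
    using lie_swap[of "\<^bold>[x, y\<^bold>]" z] lie_swap[of x z] by (simp_all add: lie_minus_right)
  moreover have "\<^bold>[x, \<^bold>[y, z\<^bold>]\<^bold>] = - (\<^bold>[y, \<^bold>[z, x\<^bold>]\<^bold>] + \<^bold>[z, \<^bold>[x, y\<^bold>]\<^bold>])"
    using lie_jacobi[of x y z] by (simp only: eq_neg_iff_add_eq_0 add.assoc)
  ultimately show ?thesis by simp
qed

lemma lie_span_right:
  assumes "x \<in> cvec.span S" "\<And>s. s \<in> S \<Longrightarrow> \<^bold>[a, s\<^bold>] \<in> T" "cvec.subspace T"
  shows "\<^bold>[a, x :: 'a::complex_lie_algebra\<^bold>] \<in> T"
  using assms(1)
proof (induction rule: cvec.span_induct_alt)
  case base
  then show ?case using assms(3) by (simp add: cvec.subspace_0)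
next
  case (step c x y)
  then show ?case
    using assms(2,3)
    by (simp add: lie_add_right lie_scale_right cvec.subspace_add cvec.subspace_scale)
qed

lemma lie_hom_linear: "lie_hom f \<Longrightarrow> Vector_Spaces.linear scaleC scaleC f"
  by (simp add: lie_hom_def)

lemma lie_hom_bracket: "lie_hom f \<Longrightarrow> f \<^bold>[x, y\<^bold>] = \<^bold>[f x, f y\<^bold>]"
  by (simp add: lie_hom_def)

lemma lie_hom_add: "lie_hom f \<Longrightarrow> f (x + y) = f x + f y"
  using linear.axioms module_hom.add by (metis lie_hom_linear linear_iff_module_hom)

lemma lie_hom_scale: "lie_hom f \<Longrightarrow> f (c *\<^sub>C x) = c *\<^sub>C f x"
  using module_hom.scale by (metis lie_hom_linear linear_iff_module_hom)

lemma lie_hom_zero: "lie_hom f \<Longrightarrow> f 0 = 0"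
  using lie_hom_add[of f 0 0] by simp

lemma lie_hom_diff: "lie_hom f \<Longrightarrow> f (x - y) = f x - f y"
  using lie_hom_add[of f "x - y" y] by simp

lemma lie_hom_sum: "lie_hom f \<Longrightarrow> f (\<Sum>i\<in>S. g i) = (\<Sum>i\<in>S. f (g i))"
  by (induction S rule: infinite_finite_induct) (simp_all add: lie_hom_add lie_hom_zero)

lemma lie_homI:
  assumes "\<And>x y. f (x + y) = f x + f y" "\<And>c x. f (c *\<^sub>C x) = c *\<^sub>C f x"
    "\<And>x y. f \<^bold>[x, y\<^bold>] = \<^bold>[f x, f y\<^bold>]"
  shows "lie_hom f"
  unfolding lie_hom_def using assms by (auto intro!: Vector_Spaces.linear.intro
    module_hom.intro module_hom_axioms.intro cvec.vector_space_axioms cvec.module_axioms)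

lemma lie_hom_free_lie_extend: "lie_hom (free_lie_extend v)"
  by (rule lie_homI) (transfer, simp)+

lemma free_lie_extend_gen [simp]: "free_lie_extend v (free_gen x) = v x"
  by transfer simp

text \<open>By uniqueness in the universal property, \<open>f\<close> is the evaluation of Lie terms
  at its values on the generators, so an induction on terms keeps the values in the subalgebra
  \<open>S\<close>.\<close>

lemma lie_hom_range_subset:
  assumes f: "lie_hom (f :: 'x free_lie \<Rightarrow> 'a::complex_lie_algebra)"
    and gen: "\<And>x. f (free_gen x) \<in> S" and S: "cvec.subspace S"
    and br: "\<And>x y. x \<in> S \<Longrightarrow> y \<in> S \<Longrightarrow> \<^bold>[x, y\<^bold>] \<in> S"
  shows "range f \<subseteq> S"
proof -
  define v where "v = f \<circ> free_gen"
  have eq: "f = free_lie_extend v"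
    using free_lie_universal[of v] f lie_hom_free_lie_extend[of v] by (auto simp: v_def)
  have "lie_term_eval v t \<in> S" for t
    using gen S br
    by (induction t)
       (auto simp: v_def cvec.subspace_0 cvec.subspace_add cvec.subspace_scale cvec.subspace_neg)
  then have "free_lie_extend v x \<in> S" for x
    by (induct x rule: free_lie.abs_induct) (simp add: free_lie_extend.abs_eq)
  then show ?thesis by (auto simp: eq)
qed

lemma lie_hom_kills_ideal_generated:
  assumes f: "lie_hom f" and R: "\<And>x. x \<in> R \<Longrightarrow> f x = 0" and x: "x \<in> lie_ideal_generated R"
  shows "f x = 0"
proof -
  have "lie_ideal {x. f x = 0}"
    using f by (auto simp: lie_ideal_def cvec.subspace_def lie_hom_zero lie_hom_add lie_hom_scale
        lie_hom_bracket)
  then show ?thesis using x R by (auto simp: lie_ideal_generated_def)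
qed

text \<open>The coefficients are attached to the indices in \<open>S\<close>, not to the vectors, so
  \<open>g\<close> may repeat a value. It is applied to \<open>gen_e\<close> and
  \<open>gen_f\<close> before their independence is available.\<close>

lemma span_image_coeffs:
  assumes "finite S" "x \<in> cvec.span (g ` S)"
  shows "\<exists>c. x = (\<Sum>i\<in>S. c i *\<^sub>C g i)"
  using assms
proof (induction S arbitrary: x rule: finite_induct)
  case empty
  then show ?case by simp
next
  case (insert a S)
  then obtain k where "x - k *\<^sub>C g a \<in> cvec.span (g ` S)"
    by (auto simp: cvec.span_breakdown_eq)
  then obtain c where c: "x - k *\<^sub>C g a = (\<Sum>i\<in>S. c i *\<^sub>C g i)" using insert.IH by blast
  have "x = (\<Sum>i\<in>insert a S. (c(a := k)) i *\<^sub>C g i)"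
    using insert.hyps c
    by (simp add: algebra_simps) (smt (verit, ccfv_threshold) sum.cong add.commute diff_eq_eq)
  then show ?case by blast
qed

text \<open>The centralizer of \<open>t\<close> is a subalgebra, because bracketing with
  \<open>t\<close> is a derivation; commuting with generators is therefore enough.\<close>

lemma lie_annihilator_subalgebra:
  "cvec.subspace {x. \<^bold>[t, x\<^bold>] = (0::'a::complex_lie_algebra)}"
  "\<^bold>[t, x\<^bold>] = 0 \<Longrightarrow> \<^bold>[t, y\<^bold>] = 0 \<Longrightarrow> \<^bold>[t, \<^bold>[x, y\<^bold>]\<^bold>] = (0::'a::complex_lie_algebra)"
  by (auto simp: cvec.subspace_def lie_add_right lie_scale_right lie_derivation[of t])

lemma lie_hom_funpow: "lie_hom f \<Longrightarrow> f ((lie_bracket x ^^ n) y) = (lie_bracket (f x) ^^ n) (f y)"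
  by (induction n) (simp_all add: lie_hom_bracket)

text \<open>Bracketing \<open>m\<close> times with \<open>a *\<^sub>C x\<close> only brings out the
  factor \<open>a ^ m\<close>. The lemma carries the Serre relations over to new generators when the
  real one is merely rescaled.\<close>

lemma funpow_lie_bracket_scaled_sum_eq_0:
  fixes x :: "'a::complex_lie_algebra"
  assumes "\<And>l. l \<in> S \<Longrightarrow> (lie_bracket x ^^ n) (y l) = 0"
  shows "(lie_bracket (a *\<^sub>C x) ^^ n) (\<Sum>l\<in>S. c l *\<^sub>C y l) = 0"
proof -
  have "(lie_bracket (a *\<^sub>C x) ^^ m) (\<Sum>l\<in>S. c l *\<^sub>C y l)
    = (\<Sum>l\<in>S. (a ^ m * c l) *\<^sub>C (lie_bracket x ^^ m) (y l))" for m
    by (induction m)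
      (simp_all add: lie_sum_right lie_scale_left lie_scale_right scaleC_scaleC
        cvec.scale_sum_right mult.assoc)
  then show ?thesis using assms by simp
qed

section \<open>The Cartan subalgebra\<close>

context bkm_algebra
begin

lemma \<pi>_relator: "x \<in> bkm_relators A \<Longrightarrow> \<pi> x = 0"
  by (rule kernel) (auto simp: bkm_ideal_def lie_ideal_generated_def)

lemma bracket_e_f: "\<^bold>[gen_e i, gen_f j\<^bold>] = (if i = j then gen_h i else 0)"
  using \<pi>_relator[OF bkm_relators.ef_same[where i=i and A=A]] \<pi>_relator[OF bkm_relators.ef_diff[where i=i and j=j and A=A]]
  by (auto simp: gen_h_def gen_f_def gen_e_def hom lie_hom_diff lie_hom_bracket)

lemma bracket_f_e: "\<^bold>[gen_f i, gen_e j\<^bold>] = (if i = j then - gen_h i else 0)"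
  using bracket_e_f[of j i] lie_swap[of "gen_f i" "gen_e j"] by auto

lemma bracket_e_e: "A i j = 0 \<Longrightarrow> \<^bold>[gen_e i, gen_e j\<^bold>] = 0"
  using \<pi>_relator[OF bkm_relators.ee[where A=A and i=i and j=j]]
  by (auto simp: gen_e_def hom lie_hom_bracket)

lemma bracket_f_f: "A i j = 0 \<Longrightarrow> \<^bold>[gen_f i, gen_f j\<^bold>] = 0"
  using \<pi>_relator[OF bkm_relators.ff[where A=A and i=i and j=j]]
  by (auto simp: gen_f_def hom lie_hom_bracket)

lemma serre_gen_e:
  "0 < A i i \<Longrightarrow> i \<noteq> j \<Longrightarrow> (lie_bracket (gen_e i) ^^ nat \<lfloor>1 - A i j\<rfloor>) (gen_e j) = 0"
  using \<pi>_relator[OF bkm_relators.serre_e[where A=A and i=i and j=j]]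
  by (simp add: gen_e_def hom lie_hom_funpow)

lemma serre_gen_f:
  "0 < A i i \<Longrightarrow> i \<noteq> j \<Longrightarrow> (lie_bracket (gen_f i) ^^ nat \<lfloor>1 - A i j\<rfloor>) (gen_f j) = 0"
  using \<pi>_relator[OF bkm_relators.serre_f[where A=A and i=i and j=j]]
  by (simp add: gen_f_def hom lie_hom_funpow)

text \<open>Since \<open>gen_h i\<close> is the bracket of \<open>gen_e i\<close> and
  \<open>gen_f i\<close>, the \<open>gen_e\<close> and \<open>gen_f\<close> alone generate the image
  of \<open>\<pi>\<close>.\<close>

lemma range_\<pi>_subset:
  assumes "cvec.subspace S" "\<And>x y. x \<in> S \<Longrightarrow> y \<in> S \<Longrightarrow> \<^bold>[x, y\<^bold>] \<in> S"
    and e: "\<And>i. gen_e i \<in> S" and f: "\<And>i. gen_f i \<in> S"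
  shows "range \<pi> \<subseteq> S"
proof (rule lie_hom_range_subset[OF hom _ assms(1,2)])
  have "gen_h i \<in> S" for i
    using assms(2)[OF e f, of i i] by (simp add: bracket_e_f)
  then show "\<pi> (free_gen x) \<in> S" for x
    using e f by (cases x) (simp_all add: gen_h_def gen_e_def gen_f_def)
qed

lemma gen_h_in_cartan: "gen_h i \<in> cartan"
  by (auto simp: cartan_def intro: cvec.span_base)

lemma subspace_cartan: "cvec.subspace cartan"
  by (simp add: cartan_def)

end

section \<open>Simple roots, weights and the bilinear form\<close>

context bkm_algebra_form
begin

lemma q_pos: "0 < q i"
  using q_symmetrizer by (simp add: symmetrizer_def)

lemma simple_root_in_cartan: "simple_root i \<in> cartan"
  by (simp add: simple_root_def cvec.subspace_scale gen_h_in_cartan subspace_cartan)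

lemma gen_h_eq: "gen_h i = complex_of_real (1 / q i) *\<^sub>C simple_root i"
  using q_pos[of i] by (simp add: simple_root_def scaleC_scaleC scaleC_one flip: of_real_mult)

lemma B_simple_root: "B (simple_root i) (simple_root j) = complex_of_real (q i * A i j)"
  unfolding simple_root_def by (rule B_simple)

lemma bracket_cartan_e: "t \<in> cartan \<Longrightarrow> \<^bold>[t, gen_e i\<^bold>] = B (simple_root i) t *\<^sub>C gen_e i"
  unfolding simple_root_def by (rule weight_e)

lemma bracket_cartan_f: "t \<in> cartan \<Longrightarrow> \<^bold>[t, gen_f i\<^bold>] = - B (simple_root i) t *\<^sub>C gen_f i"
  unfolding simple_root_def by (rule weight_f)

lemma B_zero_left: "t \<in> cartan \<Longrightarrow> B 0 t = 0"
  using B_scale[of 0 t 0] subspace_cartan by (simp add: cvec.subspace_0)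

lemma B_neg_left: "s \<in> cartan \<Longrightarrow> t \<in> cartan \<Longrightarrow> B (- s) t = - B s t"
  using B_scale[of s t "-1"] by simp

lemma gen_h_nonzero: "simple_root_norm i \<noteq> 0 \<Longrightarrow> gen_h i \<noteq> 0"
  using B_simple_root[of i i] B_zero_left[OF simple_root_in_cartan[of i]]
  by (auto simp: simple_root_def simple_root_norm_def)

text \<open>If \<open>d\<close> and \<open>k\<close> have the same weights, then
  \<open>d - k\<close> commutes with all \<open>gen_e\<close> and \<open>gen_f\<close>, hence with
  the whole image of \<open>\<pi>\<close>. So \<open>d\<close> acts there as the inner derivation of
  \<open>k\<close>, and outerness forces \<open>d = 0\<close>.\<close>

lemma outer_weight_eq_0:
  assumes d: "d \<in> D" and k: "k \<in> cvec.span (range gen_h)"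
    and eq: "\<And>i. B (simple_root i) d = B (simple_root i) k"
  shows "d = 0"
proof -
  have dc: "d \<in> cartan" and kc: "k \<in> cartan"
    using d k cvec.span_mono[of "range gen_h" "range gen_h \<union> D"]
    by (auto simp: cartan_def intro: cvec.span_base)
  have "range \<pi> \<subseteq> {x. \<^bold>[d - k, x\<^bold>] = 0}"
  proof (rule range_\<pi>_subset[OF lie_annihilator_subalgebra(1)])
    show "gen_e i \<in> {x. \<^bold>[d - k, x\<^bold>] = 0}" "gen_f i \<in> {x. \<^bold>[d - k, x\<^bold>] = 0}" for i
      using dc kc eq by (simp_all add: lie_diff_left bracket_cartan_e bracket_cartan_f)
  qed (use lie_annihilator_subalgebra(2) in blast)
  then have "\<^bold>[d, x\<^bold>] = \<^bold>[k, x\<^bold>]" if "x \<in> range \<pi>" for x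
    using that by (auto simp: lie_diff_left)
  moreover have "k \<in> range \<pi>"
    using k cvec.span_minimal[of "range gen_h" "range \<pi>"] image_ideal
    by (auto simp: lie_ideal_def gen_h_def)
  ultimately show ?thesis using D_outer d by blast
qed

end

section \<open>Consequences of rank 2: nondegeneracy and the absence of outer derivations\<close>

context fricke_lie_algebra
begin

lemma gen_h_neq_0: "gen_h i \<noteq> 0"
  using gen_h_nonzero no_norm_zero by blast

text \<open>Were the real simple root the only one, every element of \<open>D\<close> would have the
  weight of a multiple of that root and so vanish. The Cartan subalgebra would then be spanned by
  one vector, against rank 2.\<close>

lemma ex_imaginary_simple_root:
  assumes i0: "simple_root_norm i0 > 0"
  shows "\<exists>j. simple_root_norm j < 0"
proof (rule ccontr)
  assume "\<nexists>j. simple_root_norm j < 0"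
  then have "simple_root_norm j > 0" for j
    using no_norm_zero[of j] by (meson linorder_neqE)
  then have only: "j = i0" for j
    using one_real i0 by blast
  have "d = 0" if d: "d \<in> D" for d
  proof (rule outer_weight_eq_0[OF d])
    \<comment> \<open>The coefficient of the projection of \<open>d\<close> onto the real root,
      which makes the two weights agree.\<close>
    define c where "c = B (simple_root i0) d / B (simple_root i0) (simple_root i0)"
    have nz: "B (simple_root i0) (simple_root i0) \<noteq> 0"
      using i0 by (auto simp: B_simple_root simple_root_norm_def)
    show "c *\<^sub>C simple_root i0 \<in> cvec.span (range gen_h)"
      by (simp add: simple_root_def cvec.span_scale cvec.span_base)
    have "B (simple_root i0) (c *\<^sub>C simple_root i0) = c * B (simple_root i0) (simple_root i0)"
      by (metis B_scale B_sym cvec.subspace_scale simple_root_in_cartan subspace_cartan)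
    then show "B (simple_root i) d = B (simple_root i) (c *\<^sub>C simple_root i0)" for i
      using nz only[of i] by (simp add: c_def)
  qed
  then have "range gen_h \<union> D \<subseteq> cvec.span {gen_h i0}"
    using only by (auto intro: cvec.span_base cvec.span_zero) (metis cvec.span_base singletonI)
  then have "cartan \<subseteq> cvec.span {gen_h i0}"
    unfolding cartan_def by (rule cvec.span_minimal) simp
  then have "cvec.dim cartan \<le> card {gen_h i0}"
    by (rule cvec.dim_le_card) simp
  then show False using rank by simp
qed

text \<open>For a real root and an imaginary one the Gram determinant is a negative number minus a
  square, hence nonzero. The two roots are thus independent, fill the 2-dimensional Cartan
  subalgebra, and detect its elements through \<open>B\<close>.\<close>

lemma cartan_spanned_by_two_roots:
  obtains i j where "cartan = cvec.span {simple_root i, simple_root j}"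
    "\<And>t. t \<in> cartan \<Longrightarrow> B (simple_root i) t = 0 \<Longrightarrow> B (simple_root j) t = 0 \<Longrightarrow> t = 0"
proof -
  obtain i where i: "simple_root_norm i > 0" using one_real by blast
  then obtain j where j: "simple_root_norm j < 0" using ex_imaginary_simple_root by blast
  let ?r = "simple_root i" and ?s = "simple_root j"
  \<comment> \<open>Linearity is assumed in the first argument only; symmetry on the Cartan
    subalgebra moves it to the second.\<close>
  have comb: "B r (a *\<^sub>C ?r + b *\<^sub>C ?s) = a * B r ?r + b * B r ?s" if "r \<in> cartan" for r a b
  proof -
    have ar: "a *\<^sub>C ?r \<in> cartan" and bs: "b *\<^sub>C ?s \<in> cartan" and "a *\<^sub>C ?r + b *\<^sub>C ?s \<in> cartan"
      by (simp_all add: cvec.subspace_scale cvec.subspace_add simple_root_in_cartan subspace_cartan)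
    then show ?thesis
      using that by (simp add: B_sym[OF that] B_add B_scale simple_root_in_cartan)
  qed
  have nondeg: "a = 0 \<and> b = 0"
    if "B ?r (a *\<^sub>C ?r + b *\<^sub>C ?s) = 0" "B ?s (a *\<^sub>C ?r + b *\<^sub>C ?s) = 0" for a b
  proof -
    define x y z where "x = q i * A i i" and "y = q j * A j j" and "z = q i * A i j"
    have z': "z = q j * A j i"
      using q_symmetrizer by (simp add: symmetrizer_def z_def)
    have 1: "a * x + b * z = 0" and 2: "a * z + b * y = 0"
      using that comb[of ?r] comb[of ?s] simple_root_in_cartan
      by (simp_all add: B_simple_root x_def y_def z_def z'[unfolded z_def])
    have "x > 0" "y < 0" using i j by (simp_all add: simple_root_norm_def x_def y_def)
    then have "x * y < 0" by (simp add: mult_less_0_iff)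
    then have "x * y - z * z \<noteq> 0" using zero_le_square[of z] by linarith
    then have det: "complex_of_real x * y - complex_of_real z * z \<noteq> 0"
      by (metis of_real_diff of_real_eq_0_iff of_real_mult)
    \<comment> \<open>Cramer's rule: this combination of the two equations eliminates
      \<open>b\<close>; the next one eliminates \<open>a\<close>.\<close>
    have "a * (complex_of_real x * y - complex_of_real z * z) = 0"
    proof -
      have "a * (complex_of_real x * y - complex_of_real z * z)
        = y * (a * x + b * z) - z * (a * z + b * y)" by (simp add: algebra_simps)
      then show ?thesis using 1 2 by simp
    qed
    moreover have "b * (complex_of_real x * y - complex_of_real z * z) = 0"
    proof -
      have "b * (complex_of_real x * y - complex_of_real z * z)
        = x * (a * z + b * y) - z * (a * x + b * z)" by (simp add: algebra_simps)
      then show ?thesis using 1 2 by simp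
    qed
    ultimately show ?thesis using det by simp
  qed
  have B0: "B r 0 = 0" if "r \<in> cartan" for r
    using comb[OF that, of 0 0] by simp
  have lin: "a = 0 \<and> b = 0" if "a *\<^sub>C ?r + b *\<^sub>C ?s = 0" for a b
    using nondeg[of a b] that B0 simple_root_in_cartan by simp
  have ind1: "?r \<notin> cvec.span {?s}"
  proof
    assume "?r \<in> cvec.span {?s}"
    then obtain k where "?r = k *\<^sub>C ?s"
      by (auto simp: cvec.span_breakdown_eq)
    then show False using lin[of 1 "- k"] by simp
  qed
  have "?s \<noteq> 0" using lin[of 0 1] by auto
  moreover have "?r \<noteq> ?s" using ind1 cvec.span_base[of ?s "{?s}"] by auto
  ultimately have ind: "cvec.independent {?r, ?s}" and card2: "card {?r, ?s} = 2"
    using ind1 by (simp_all add: cvec.independent_insert)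
  obtain b where b: "b \<subseteq> cartan" "cvec.independent b" "cartan \<subseteq> cvec.span b" "card b = 2"
    using cvec.basis_exists[of cartan] rank by metis
  \<comment> \<open>An infinite set has \<open>card\<close> equal to 0, so cardinality 2 already
    forces finiteness.\<close>
  have fin: "finite b" using b(4) card.infinite by fastforce
  have "cartan \<subseteq> cvec.span {?r, ?s}"
  proof
    fix t assume t: "t \<in> cartan"
    show "t \<in> cvec.span {?r, ?s}"
    proof (rule ccontr)
      assume nt: "t \<notin> cvec.span {?r, ?s}"
      \<comment> \<open>A vector outside the span would give three independent vectors inside the
        span of the two elements of \<open>b\<close>.\<close>
      then have "cvec.independent (insert t {?r, ?s})" using ind by (simp add: cvec.independent_insertI)
      moreover have "insert t {?r, ?s} \<subseteq> cvec.span b" using t b simple_root_in_cartan by auto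
      ultimately have "card (insert t {?r, ?s}) \<le> 2"
        using cvec.independent_span_bound[OF fin] b(4) by metis
      moreover have "t \<notin> {?r, ?s}" using nt cvec.span_base by blast
      ultimately show False using card2 by simp
    qed
  qed
  moreover have "cvec.span {?r, ?s} \<subseteq> cartan"
    by (rule cvec.span_minimal) (auto simp: simple_root_in_cartan subspace_cartan)
  ultimately have eq: "cartan = cvec.span {?r, ?s}" by blast
  show ?thesis
  proof (rule that[OF eq])
    fix t assume t: "t \<in> cartan" "B ?r t = 0" "B ?s t = 0"
    then obtain a b where ab: "t - a *\<^sub>C ?r = b *\<^sub>C ?s"
      unfolding eq by (auto simp: cvec.span_breakdown_eq)
    then have "t = a *\<^sub>C ?r + b *\<^sub>C ?s" by (simp add: algebra_simps)
    then show "t = 0" using nondeg[of a b] t by simp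
  qed
qed

lemma cartan_nondegenerate:
  assumes "t \<in> cartan" "\<And>i. B (simple_root i) t = 0"
  shows "t = 0"
  using assms by (metis cartan_spanned_by_two_roots)

lemma cartan_eq_span_h: "cartan = cvec.span (range gen_h)"
proof -
  obtain i j where "cartan = cvec.span {simple_root i, simple_root j}"
    by (rule cartan_spanned_by_two_roots)
  moreover have "\<dots> \<subseteq> cvec.span (range gen_h)"
    by (rule cvec.span_minimal)
       (auto simp: simple_root_def intro: cvec.span_scale cvec.span_base)
  moreover have "cvec.span (range gen_h) \<subseteq> cartan"
    unfolding cartan_def by (rule cvec.span_mono) auto
  ultimately show ?thesis by blast
qed

text \<open>The Cartan subalgebra contains \<open>D\<close> and is spanned by the
  \<open>gen_h i\<close>, so \<open>D\<close> lies in the image of \<open>\<pi>\<close>. As it also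
  meets that image trivially, it is zero.\<close>

lemma range_\<pi>: "range \<pi> = UNIV"
proof -
  have sub: "cvec.subspace (range \<pi>)" using image_ideal by (simp add: lie_ideal_def)
  have "cartan \<subseteq> range \<pi>"
    unfolding cartan_eq_span_h by (rule cvec.span_minimal[OF _ sub]) (auto simp: gen_h_def)
  moreover have "D \<subseteq> cartan" by (auto simp: cartan_def intro: cvec.span_base)
  ultimately have "D = {0}" using D_int by blast
  then show ?thesis using D_sum by auto
qed

text \<open>An induction principle for the whole algebra: with \<open>D\<close> gone, the
  \<open>gen_e\<close> and \<open>gen_f\<close> generate it.\<close>

lemma generated_induct:
  assumes "cvec.subspace S" "\<And>x y. x \<in> S \<Longrightarrow> y \<in> S \<Longrightarrow> \<^bold>[x, y\<^bold>] \<in> S"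
    and "\<And>i. gen_e i \<in> S" and "\<And>i. gen_f i \<in> S"
  shows "x \<in> S"
  using range_\<pi>_subset[of S] assms range_\<pi> by blast

end

section \<open>Triangular decomposition\<close>

text \<open>Right-normed monomials in the family \<open>e\<close>. With \<open>gen_e\<close> and
  \<open>gen_f\<close> in this place they give the two nilpotent parts of the triangular
  decomposition.\<close>

inductive_set nested_brackets :: "('i \<Rightarrow> 'g::complex_lie_algebra) \<Rightarrow> 'g set" for e where
  gen: "e i \<in> nested_brackets e"
| bracket: "w \<in> nested_brackets e \<Longrightarrow> \<^bold>[e i, w\<^bold>] \<in> nested_brackets e"

text \<open>Stated for abstract \<open>e\<close>, \<open>f\<close> and \<open>H\<close> so that it
  serves both halves, with \<open>gen_e\<close> and \<open>gen_f\<close> exchanged. Elements of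
  \<open>H\<close> and the \<open>f j\<close> are pushed inward by the derivation rule until they
  meet a generator, while \<open>e i\<close> lengthens a monomial.\<close>

lemma nested_brackets_stable:
  assumes H: "cvec.subspace H"
    and wt: "\<And>t i. t \<in> H \<Longrightarrow> \<^bold>[t, e i\<^bold>] = \<alpha> i t *\<^sub>C e i"
    and fe: "\<And>i j. \<^bold>[f j, e i\<^bold>] \<in> H"
  shows "x \<in> cvec.span (nested_brackets e) \<Longrightarrow> t \<in> H \<Longrightarrow> \<^bold>[t, x\<^bold>] \<in> cvec.span (nested_brackets e)"
    and "x \<in> cvec.span (nested_brackets e \<union> H) \<Longrightarrow> \<^bold>[e i, x\<^bold>] \<in> cvec.span (nested_brackets e)"
    and "w \<in> nested_brackets e \<Longrightarrow> \<^bold>[f j, w\<^bold>] \<in> cvec.span (nested_brackets e \<union> H)"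
proof -
  let ?N = "nested_brackets e"
  have et: "\<^bold>[e i, t\<^bold>] \<in> cvec.span ?N" if "t \<in> H" for i t
    using that lie_swap[of "e i" t]
    by (simp add: wt cvec.span_neg cvec.span_scale cvec.span_base nested_brackets.gen)
  have e: "\<^bold>[e i, x\<^bold>] \<in> cvec.span ?N" if "x \<in> cvec.span (?N \<union> H)" for i x
    using that by (rule lie_span_right)
      (auto simp: et intro: cvec.span_base nested_brackets.bracket)
  then show "x \<in> cvec.span (?N \<union> H) \<Longrightarrow> \<^bold>[e i, x\<^bold>] \<in> cvec.span ?N" .
  have e': "\<^bold>[e i, x\<^bold>] \<in> cvec.span ?N" if "x \<in> cvec.span ?N" for i x
    using e[of x i] that cvec.span_mono[of ?N "?N \<union> H"] by blast
  have tw: "\<^bold>[t, w\<^bold>] \<in> cvec.span ?N" if "w \<in> ?N" "t \<in> H" for w t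
    using that(1)
  proof induction
    case (gen i)
    then show ?case
      by (simp add: wt that cvec.span_scale cvec.span_base nested_brackets.gen)
  next
    case (bracket w i)
    then show ?case
      by (subst lie_derivation)
        (simp add: wt that lie_scale_left e' cvec.span_add cvec.span_scale cvec.span_base
          nested_brackets.bracket)
  qed
  then show t: "\<^bold>[t, x\<^bold>] \<in> cvec.span ?N" if "x \<in> cvec.span ?N" "t \<in> H" for x t
    using that by (auto intro: lie_span_right)
  show "\<^bold>[f j, w\<^bold>] \<in> cvec.span (?N \<union> H)" if "w \<in> ?N" for w
    using that
  proof induction
    case (gen i)
    then show ?case using fe by (auto intro: cvec.span_base)
  next
    case (bracket w i)
    have "\<^bold>[\<^bold>[f j, e i\<^bold>], w\<^bold>] + \<^bold>[e i, \<^bold>[f j, w\<^bold>]\<^bold>] \<in> cvec.span ?N"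
      using bracket.IH t[OF cvec.span_base[OF bracket.hyps] fe] e by (intro cvec.span_add)
    then show ?case
      using lie_derivation[of "f j" "e i" w] cvec.span_mono[of ?N "?N \<union> H"] by auto
  qed
qed

context fricke_lie_algebra
begin

text \<open>The span \<open>U\<close> is stable under each generator. The elements stabilising
  \<open>U\<close> form a subalgebra, hence are everything; so \<open>U\<close> is itself a
  subalgebra containing the generators.\<close>

lemma triangular_span:
  "x \<in> cvec.span (nested_brackets gen_e \<union> nested_brackets gen_f \<union> cartan)"
proof -
  let ?P = "nested_brackets gen_e" and ?M = "nested_brackets gen_f"
  define U where "U = cvec.span (?P \<union> ?M \<union> cartan)"
  have "\<^bold>[gen_f j, gen_e i\<^bold>] \<in> cartan" "\<^bold>[gen_e j, gen_f i\<^bold>] \<in> cartan" for i j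
    using gen_h_in_cartan subspace_cartan
    by (auto simp: bracket_e_f bracket_f_e cvec.subspace_0 cvec.subspace_neg)
  note stable_e = nested_brackets_stable[where e = gen_e and f = gen_f, OF subspace_cartan bracket_cartan_e this(1)]
  and stable_f = nested_brackets_stable[where e = gen_f and f = gen_e, OF subspace_cartan bracket_cartan_f this(2)]
  have PU: "cvec.span ?P \<subseteq> U" "cvec.span (?P \<union> cartan) \<subseteq> U"
    "cvec.span ?M \<subseteq> U" "cvec.span (?M \<union> cartan) \<subseteq> U"
    unfolding U_def by (rule cvec.span_mono; blast)+
  have U: "cvec.subspace U" by (simp add: U_def)
  \<comment> \<open>Bracketing with \<open>gen_e i\<close> lengthens monomials in
    \<open>gen_e\<close> and sends the Cartan subalgebra to their span; on monomials in
    \<open>gen_f\<close> it is the lowering operation of the exchanged version.\<close>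
  have e: "\<^bold>[gen_e i, x\<^bold>] \<in> U" if "x \<in> U" for x i
    using that unfolding U_def
  proof (rule lie_span_right)
    show "\<^bold>[gen_e i, s\<^bold>] \<in> cvec.span (?P \<union> ?M \<union> cartan)" if "s \<in> ?P \<union> ?M \<union> cartan" for s
      using that stable_e(2)[where x = s and i = i] stable_f(3)[where w = s and j = i] PU
      unfolding U_def by (auto intro: cvec.span_base)
  qed simp
  have f: "\<^bold>[gen_f i, x\<^bold>] \<in> U" if "x \<in> U" for x i
    using that unfolding U_def
  proof (rule lie_span_right)
    show "\<^bold>[gen_f i, s\<^bold>] \<in> cvec.span (?P \<union> ?M \<union> cartan)" if "s \<in> ?P \<union> ?M \<union> cartan" for s
      using that stable_f(2)[where x = s and i = i] stable_e(3)[where w = s and j = i] PU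
      unfolding U_def by (auto intro: cvec.span_base)
  qed simp
  have "y \<in> {y. \<forall>x\<in>U. \<^bold>[y, x\<^bold>] \<in> U}" for y
  proof (rule generated_induct)
    show "cvec.subspace {y. \<forall>x\<in>U. \<^bold>[y, x\<^bold>] \<in> U}"
      using U by (auto simp: cvec.subspace_def lie_add_left lie_scale_left)
    show "\<^bold>[a, b\<^bold>] \<in> {y. \<forall>x\<in>U. \<^bold>[y, x\<^bold>] \<in> U}"
      if "a \<in> {y. \<forall>x\<in>U. \<^bold>[y, x\<^bold>] \<in> U}" "b \<in> {y. \<forall>x\<in>U. \<^bold>[y, x\<^bold>] \<in> U}" for a b
    proof -
      have "\<^bold>[\<^bold>[a, b\<^bold>], x\<^bold>] = \<^bold>[a, \<^bold>[b, x\<^bold>]\<^bold>] - \<^bold>[b, \<^bold>[a, x\<^bold>]\<^bold>]" for x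
        using lie_derivation[of a b x] by simp
      then show ?thesis using that cvec.subspace_diff[OF U] by simp
    qed
  next
    show "gen_e i \<in> {y. \<forall>x\<in>U. \<^bold>[y, x\<^bold>] \<in> U}" "gen_f i \<in> {y. \<forall>x\<in>U. \<^bold>[y, x\<^bold>] \<in> U}" for i
      using e f by blast+
  qed
  then have br: "\<^bold>[y, x\<^bold>] \<in> U" if "x \<in> U" for y x using that by blast
  have "x \<in> U"
  proof (rule generated_induct[OF U br])
    show "gen_e i \<in> U" "gen_f i \<in> U" for i
      unfolding U_def by (auto intro: cvec.span_base nested_brackets.gen)
  qed
  then show ?thesis by (simp add: U_def)
qed

end

section \<open>The graded pieces of degree (1, n) and (-1, -n)\<close>

context graded_fricke_lie_algebra
begin

lemma fst_deg: "fst (deg i) = 1"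
  using deg_real[of i] deg_imaginary[of i] no_norm_zero[of i] by (metis fst_conv linorder_neqE)

lemma deg_eq: "deg i = (1, snd (deg i))"
  using fst_deg[of i] by (metis prod.collapse)

lemma snd_deg_ge: "-1 \<le> snd (deg i)"
proof (cases "simple_root_norm i > 0")
  case True
  then show ?thesis using deg_real[of i] by simp
next
  case False
  then obtain n where "n \<ge> 1" "deg i = (1, n)"
    using deg_imaginary[of i] no_norm_zero[of i] by fastforce
  then show ?thesis by simp
qed

definition roots_of_degree :: "int \<Rightarrow> 'i set" where
  "roots_of_degree n = {i. deg i = (1, n)}"

lemma finite_roots_of_degree [simp]: "finite (roots_of_degree n)"
  using finite_multiplicity by (simp add: roots_of_degree_def)

lemma deg_eq_iff: "i \<in> roots_of_degree n \<longleftrightarrow> snd (deg i) = n"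
  using deg_eq[of i] by (simp add: roots_of_degree_def prod_eq_iff)

lemma grading_basis:
  obtains u v where "u \<in> cartan" "v \<in> cartan"
    and "\<And>m n. G m n = root_space (of_int m *\<^sub>C u + of_int n *\<^sub>C v)"
    and "\<And>i. simple_root i = u + of_int (snd (deg i)) *\<^sub>C v"
proof -
  obtain u v where "u \<in> cartan" "v \<in> cartan"
    "\<And>m n. G m n = root_space (of_int m *\<^sub>C u + of_int n *\<^sub>C v)"
    "\<And>i. simple_root i = of_int (fst (deg i)) *\<^sub>C u + of_int (snd (deg i)) *\<^sub>C v"
    using G_roots by blast
  then show thesis by (intro that[of u v]) (simp_all add: fst_deg scaleC_one)
qed

lemma simple_root_eq: "snd (deg i) = snd (deg j) \<Longrightarrow> simple_root i = simple_root j"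
  by (rule grading_basis) simp

lemma G_root_space:
  obtains r where "r \<in> cartan" "G m n = root_space r"
proof (rule grading_basis)
  fix u v
  assume "u \<in> cartan" "v \<in> cartan"
    and "\<And>m n. G m n = root_space (of_int m *\<^sub>C u + of_int n *\<^sub>C v)"
  then show thesis
    by (intro that[of "of_int m *\<^sub>C u + of_int n *\<^sub>C v"])
      (simp_all add: cvec.subspace_add cvec.subspace_scale subspace_cartan)
qed

lemma G_pos_root_space: "G 1 (snd (deg i)) = root_space (simple_root i)"
  by (rule grading_basis) (simp add: scaleC_one)

lemma G_neg_root_space: "G (-1) (- snd (deg i)) = root_space (- simple_root i)"
  by (rule grading_basis) simp

lemma gen_e_in_G: "gen_e i \<in> G 1 (snd (deg i))"
  unfolding G_pos_root_space by (simp add: root_space_def bracket_cartan_e)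

lemma gen_f_in_G: "gen_f i \<in> G (-1) (- snd (deg i))"
  unfolding G_neg_root_space
  by (simp add: root_space_def bracket_cartan_f B_neg_left simple_root_in_cartan)

text \<open>Turns independence of finite families into a trivial intersection: a vector of one piece
  that is a sum over other pieces yields a vanishing family once its negative is put in its own
  slot.\<close>

lemma G_independent_complement:
  assumes z: "z \<in> G m n" and zs: "z \<in> cvec.span (\<Union>(k, l)\<in>-{(m, n)}. G k l)"
  shows "z = 0"
proof -
  have "\<exists>S w. finite S \<and> (m, n) \<notin> S \<and> (\<forall>k l. w (k, l) \<in> G k l) \<and> z = (\<Sum>p\<in>S. w p)"
    using zs
  proof (induction rule: cvec.span_induct_alt)
    case base
    have "\<forall>k l. (\<lambda>_. 0) (k, l) \<in> G k l" using G_subspace by (simp add: cvec.subspace_0)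
    then show ?case by (intro exI[of _ "{}"] exI[of _ "\<lambda>_. 0"]) simp
  next
    case (step c x y)
    then obtain S w where S: "finite S" "(m, n) \<notin> S" "\<And>k l. w (k, l) \<in> G k l" "y = (\<Sum>p\<in>S. w p)"
      by auto
    obtain k l where kl: "(k, l) \<noteq> (m, n)" "x \<in> G k l" using step by auto
    \<comment> \<open>Two separate summands, because the slot \<open>(k, l)\<close> of the new
      vector may already belong to \<open>S\<close>. Values outside the enlarged set are 0.\<close>
    define w' where "w' p = (if p = (k, l) then c *\<^sub>C x else 0) + (if p \<in> S then w p else 0)" for p
    have "w' (k', l') \<in> G k' l'" for k' l'
      using kl S(3) G_subspace
      by (auto simp: w'_def cvec.subspace_0 intro!: cvec.subspace_add cvec.subspace_scale)
    moreover have "(\<Sum>p\<in>insert (k, l) S. w' p) = c *\<^sub>C x + y"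
    proof -
      have "(\<Sum>p\<in>insert (k, l) S. if p \<in> S then w p else 0) = (\<Sum>p\<in>S. w p)"
        using S(1) by (intro sum.mono_neutral_cong_right) auto
      then show ?thesis
        unfolding w'_def sum.distrib using S by (simp add: sum.delta)
    qed
    ultimately show ?case
      using S kl by (intro exI[of _ "insert (k, l) S"] exI[of _ w']) auto
  qed
  then obtain S w where S: "finite S" "(m, n) \<notin> S" "\<And>k l. w (k, l) \<in> G k l" "z = (\<Sum>p\<in>S. w p)"
    by auto
  define w' where "w' = w((m, n) := - z)"
  have "w' (m, n) = 0"
  proof (rule G_independent)
    show "finite (insert (m, n) S)" using S by simp
    show "w' (k, l) \<in> G k l" for k l
      using S z G_subspace by (auto simp: w'_def cvec.subspace_neg)
    have "(\<Sum>p\<in>S. w' p) = z"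
      using S by (auto simp: w'_def intro: sum.cong)
    then show "(\<Sum>p\<in>insert (m, n) S. w' p) = 0"
      using S by (simp add: w'_def)
  qed simp
  then show ?thesis by (simp add: w'_def)
qed

text \<open>Split an element of \<open>G m n\<close> along the two spans. The part from the other
  pieces is a difference of elements of \<open>G m n\<close>, so it vanishes by
  independence.\<close>

lemma G_eq_span_if_complement:
  assumes X: "X \<subseteq> G m n" and gen: "\<And>x. x \<in> cvec.span (X \<union> (\<Union>(k, l)\<in>-{(m, n)}. G k l))"
  shows "G m n = cvec.span X"
proof
  show span: "cvec.span X \<subseteq> G m n" using X G_subspace by (rule cvec.span_minimal)
  show "G m n \<subseteq> cvec.span X"
  proof
    fix x assume x: "x \<in> G m n"
    obtain a b where ab: "x = a + b" "a \<in> cvec.span X" "b \<in> cvec.span (\<Union>(k, l)\<in>-{(m, n)}. G k l)"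
      using gen[of x] unfolding cvec.span_Un by auto
    have "b = x - a" using ab by simp
    moreover have "a \<in> G m n" using ab span by blast
    ultimately have "b \<in> G m n" using x G_subspace by (metis cvec.subspace_diff)
    then have "b = 0" using ab(3) by (rule G_independent_complement)
    then show "x \<in> cvec.span X" using ab by simp
  qed
qed

text \<open>The first degree counts the generators in a monomial, since every simple root has first
  degree 1.\<close>

lemma nested_brackets_e_degree:
  "w \<in> nested_brackets gen_e \<Longrightarrow> w \<in> range gen_e \<or> (\<exists>m n. 2 \<le> m \<and> w \<in> G m n)"
proof (induction rule: nested_brackets.induct)
  case (bracket w i)
  have "\<exists>m n. 1 \<le> m \<and> w \<in> G m n"
    using bracket.IH
  proof
    assume "\<exists>m n. 2 \<le> m \<and> w \<in> G m n"
    then obtain m n where "2 \<le> m" "w \<in> G m n" by blast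
    then show ?thesis by (intro exI[of _ m] exI[of _ n]) simp
  qed (use gen_e_in_G in blast)
  then obtain m n where "1 \<le> m" "w \<in> G m n" by blast
  then have "2 \<le> 1 + m" "\<^bold>[gen_e i, w\<^bold>] \<in> G (1 + m) (snd (deg i) + n)"
    using G_bracket[OF gen_e_in_G] by auto
  then show ?case by blast
qed auto

lemma nested_brackets_f_degree:
  "w \<in> nested_brackets gen_f \<Longrightarrow> w \<in> range gen_f \<or> (\<exists>m n. m \<le> -2 \<and> w \<in> G m n)"
proof (induction rule: nested_brackets.induct)
  case (bracket w i)
  have "\<exists>m n. m \<le> -1 \<and> w \<in> G m n"
    using bracket.IH
  proof
    assume "\<exists>m n. m \<le> -2 \<and> w \<in> G m n"
    then obtain m n where "m \<le> -2" "w \<in> G m n" by blast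
    then show ?thesis by (intro exI[of _ m] exI[of _ n]) simp
  qed (use gen_f_in_G in blast)
  then obtain m n where "m \<le> -1" "w \<in> G m n" by blast
  then have "-1 + m \<le> -2" "\<^bold>[gen_f i, w\<^bold>] \<in> G (-1 + m) (- snd (deg i) + n)"
    using G_bracket[OF gen_f_in_G] by auto
  then show ?case by blast
qed auto

text \<open>Monomials with at least two factors have first degree at least 2 in absolute value, and
  the Cartan subalgebra has degree 0. Hence in first degree 1 and -1 only the generators themselves
  occur.\<close>

lemma span_eq_UNIV_if_generators:
  assumes e: "\<And>i. gen_e i \<in> X" and f: "\<And>i. gen_f i \<in> X"
    and G: "\<And>w k l. w \<in> G k l \<Longrightarrow> \<bar>k\<bar> \<noteq> 1 \<Longrightarrow> w \<in> X"
  shows "x \<in> cvec.span X"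
proof -
  have "w \<in> X" if "w \<in> nested_brackets gen_e" for w
    using nested_brackets_e_degree[OF that]
  proof
    assume "\<exists>m n. 2 \<le> m \<and> w \<in> G m n"
    then obtain k l where "2 \<le> k" "w \<in> G k l" by blast
    then show ?thesis using G[of w k l] by simp
  qed (use e in blast)
  moreover have "w \<in> X" if "w \<in> nested_brackets gen_f" for w
    using nested_brackets_f_degree[OF that]
  proof
    assume "\<exists>m n. m \<le> -2 \<and> w \<in> G m n"
    then obtain k l where "k \<le> -2" "w \<in> G k l" by blast
    then show ?thesis using G[of w k l] by simp
  qed (use f in blast)
  moreover have "w \<in> X" if "w \<in> cartan" for w
    using G[of w 0 0] that by (simp add: G_zero)
  ultimately have "nested_brackets gen_e \<union> nested_brackets gen_f \<union> cartan \<subseteq> X" by blast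
  then show ?thesis using triangular_span[of x] cvec.span_mono by blast
qed

text \<open>The other pieces, collected in \<open>C\<close>, contain every \<open>gen_f\<close>,
  every \<open>gen_e\<close> of another degree, and everything whose first degree is not 1 or -1.
  Together with the remaining \<open>gen_e\<close> they span the algebra.\<close>

lemma G_one: "G 1 n = cvec.span (gen_e ` roots_of_degree n)"
proof (rule G_eq_span_if_complement)
  show "gen_e ` roots_of_degree n \<subseteq> G 1 n" using gen_e_in_G by (auto simp: deg_eq_iff)
  define C where "C = (\<Union>(k, l)\<in>-{(1, n)}. G k l)"
  have C: "w \<in> C" if "w \<in> G k l" "k \<noteq> 1 \<or> l \<noteq> n" for w k l
    using that unfolding C_def by blast
  have e: "gen_e i \<in> gen_e ` roots_of_degree n \<union> C" for i
    using C[OF gen_e_in_G[of i]] by (cases "snd (deg i) = n") (auto simp: deg_eq_iff)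
  have f: "gen_f i \<in> C" for i
    using C[OF gen_f_in_G[of i]] by simp
  have "x \<in> cvec.span (gen_e ` roots_of_degree n \<union> C)" for x
  proof (rule span_eq_UNIV_if_generators)
    show "w \<in> gen_e ` roots_of_degree n \<union> C" if "w \<in> G k l" "\<bar>k\<bar> \<noteq> 1" for w k l
      using C[OF that(1)] that(2) by fastforce
  qed (use e f in auto)
  then show "x \<in> cvec.span (gen_e ` roots_of_degree n \<union> (\<Union>(k, l)\<in>-{(1, n)}. G k l))" for x
    by (simp only: C_def)
qed

lemma G_minus_one: "G (-1) (- n) = cvec.span (gen_f ` roots_of_degree n)"
proof (rule G_eq_span_if_complement)
  show "gen_f ` roots_of_degree n \<subseteq> G (-1) (- n)" using gen_f_in_G by (auto simp: deg_eq_iff)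
  define C where "C = (\<Union>(k, l)\<in>-{(-1, - n)}. G k l)"
  have C: "w \<in> C" if "w \<in> G k l" "k \<noteq> -1 \<or> l \<noteq> - n" for w k l
    using that unfolding C_def by blast
  have f: "gen_f i \<in> gen_f ` roots_of_degree n \<union> C" for i
    using C[OF gen_f_in_G[of i]] by (cases "snd (deg i) = n") (auto simp: deg_eq_iff)
  have e: "gen_e i \<in> C" for i
    using C[OF gen_e_in_G[of i]] by simp
  have "x \<in> cvec.span (gen_f ` roots_of_degree n \<union> C)" for x
  proof (rule span_eq_UNIV_if_generators)
    show "w \<in> gen_f ` roots_of_degree n \<union> C" if "w \<in> G k l" "\<bar>k\<bar> \<noteq> 1" for w k l
      using C[OF that(1)] that(2) by fastforce
  qed (use e f in auto)
  then show "x \<in> cvec.span (gen_f ` roots_of_degree n \<union> (\<Union>(k, l)\<in>-{(-1, - n)}. G k l))" for x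
    by (simp only: C_def)
qed

lemma sum_gen_e_bracket_f:
  assumes "finite S"
  shows "\<^bold>[\<Sum>i\<in>S. c i *\<^sub>C gen_e i, gen_f k\<^bold>] = (if k \<in> S then c k *\<^sub>C gen_h k else 0)"
proof -
  have "\<^bold>[\<Sum>i\<in>S. c i *\<^sub>C gen_e i, gen_f k\<^bold>] = (\<Sum>i\<in>S. if i = k then c k *\<^sub>C gen_h k else 0)"
    unfolding lie_sum_left by (intro sum.cong) (auto simp: lie_scale_left bracket_e_f)
  then show ?thesis using assms by simp
qed

lemma gen_e_neq_0: "gen_e i \<noteq> 0"
  using bracket_e_f[of i i] gen_h_neq_0[of i] by auto

text \<open>The bracket pairs the two families of generators diagonally: bracketing with
  \<open>gen_e i\<close> isolates the coefficient of \<open>gen_f i\<close>, and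
  \<open>gen_h i\<close> is nonzero.\<close>

lemma f_combination_eq_0:
  assumes z: "z \<in> G (-1) (- n)" and br: "\<And>i. i \<in> roots_of_degree n \<Longrightarrow> \<^bold>[gen_e i, z\<^bold>] = 0"
  shows "z = 0"
proof -
  obtain c where c: "z = (\<Sum>k\<in>roots_of_degree n. c k *\<^sub>C gen_f k)"
    using z span_image_coeffs[of "roots_of_degree n" z gen_f] by (auto simp: G_minus_one)
  have "c i = 0" if i: "i \<in> roots_of_degree n" for i
  proof -
    have "\<^bold>[gen_e i, z\<^bold>] = (\<Sum>k\<in>roots_of_degree n. if k = i then c i *\<^sub>C gen_h i else 0)"
      unfolding c lie_sum_right by (intro sum.cong) (auto simp: lie_scale_right bracket_e_f)
    then show ?thesis using br[OF i] i gen_h_neq_0[of i] by simp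
  qed
  then show ?thesis by (simp add: c)
qed

end

section \<open>Homogeneous automorphisms\<close>

lemma mem_homogeneous_aut_group:
  "\<sigma> \<in> carrier (homogeneous_aut_group G)
    \<longleftrightarrow> lie_hom \<sigma> \<and> bij \<sigma> \<and> (\<forall>m n. \<sigma> ` G m n = G m n)"
  by (simp add: homogeneous_aut_group_def)

lemma homogeneous_aut_inv:
  assumes \<sigma>: "\<sigma> \<in> carrier (homogeneous_aut_group G)"
  shows "inv_into UNIV \<sigma> \<in> carrier (homogeneous_aut_group G)"
proof -
  have h: "lie_hom \<sigma>" and b: "bij \<sigma>" and G: "\<And>m n. \<sigma> ` G m n = G m n"
    using \<sigma> by (auto simp: mem_homogeneous_aut_group)
  have inj: "inj \<sigma>" and s: "\<And>x. \<sigma> (inv_into UNIV \<sigma> x) = x"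
    using b by (auto simp: bij_is_inj bij_is_surj surj_f_inv_f)
  have "lie_hom (inv_into UNIV \<sigma>)"
    by (rule lie_homI; rule injD[OF inj])
      (simp_all add: s h lie_hom_add lie_hom_scale lie_hom_bracket)
  moreover have "inv_into UNIV \<sigma> ` G m n = G m n" for m n
    using G[of m n] inj by (metis image_inv_f_f)
  ultimately show ?thesis
    using b by (simp add: mem_homogeneous_aut_group bij_imp_bij_inv)
qed

lemma mem_general_linear_group:
  "X \<in> carrier (general_linear_group n) \<longleftrightarrow>
    X \<in> carrier_mat n n \<and> (\<exists>Y\<in>carrier_mat n n. Y * X = 1\<^sub>m n \<and> X * Y = 1\<^sub>m n)"
  by (auto simp: general_linear_group_def units_of_def Units_def ring_mat_def)

section \<open>Rigidity of homogeneous automorphisms\<close>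

context graded_fricke_lie_algebra
begin

lemma lie_hom_eqI:
  assumes f: "lie_hom f" and g: "lie_hom g"
    and e: "\<And>i. f (gen_e i) = g (gen_e i)" and e': "\<And>i. f (gen_f i) = g (gen_f i)"
  shows "f = g"
proof
  fix x
  have "x \<in> {x. f x = g x}"
    by (rule generated_induct)
      (auto simp: cvec.subspace_def f g e e' lie_hom_zero lie_hom_add lie_hom_scale lie_hom_bracket)
  then show "f x = g x" by simp
qed

text \<open>Both sides are values of \<open>B\<close> on simple roots, and a simple root is
  determined by its degree. Individual entries of \<open>A\<close> still carry the factor
  \<open>q\<close> of their row.\<close>

lemma symmetrized_entry_eq:
  assumes "snd (deg i) = snd (deg i')" "snd (deg j) = snd (deg j')"
  shows "q i * A i j = q i' * A i' j'"
proof -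
  have "complex_of_real (q i * A i j) = complex_of_real (q i' * A i' j')"
    using simple_root_eq[OF assms(1)] simple_root_eq[OF assms(2)] B_simple_root by metis
  then show ?thesis by (simp only: of_real_eq_iff)
qed

lemma cartan_matrix_entry_eq: "snd (deg j) = snd (deg j') \<Longrightarrow> A i j = A i j'"
  using symmetrized_entry_eq[of i i j j'] q_pos[of i] by simp

lemma cartan_matrix_entry_eq_0:
  assumes "snd (deg i) = snd (deg i')" "snd (deg j) = snd (deg j')" "A i j = 0"
  shows "A i' j' = 0"
  using symmetrized_entry_eq[OF assms(1,2)] q_pos[of i'] assms(3) by simp

text \<open>The norm of a simple root depends only on its degree, so any other root in this degree
  would be a second real one.\<close>

lemma roots_of_degree_real:
  assumes "0 < A i i"
  shows "roots_of_degree (snd (deg i)) = {i}"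
proof -
  have pos: "simple_root_norm i > 0"
    using assms q_pos[of i] by (simp add: simple_root_norm_def)
  have "k = i" if "snd (deg k) = snd (deg i)" for k
  proof -
    have "simple_root_norm k > 0"
      using pos symmetrized_entry_eq[OF that that] by (simp add: simple_root_norm_def)
    then show ?thesis using pos one_real by blast
  qed
  then show ?thesis by (auto simp: deg_eq_iff)
qed

text \<open>The nonzero vector \<open>\<sigma> (gen_e i)\<close> stays in the root space of
  \<open>gen_e i\<close>. Computing its bracket with \<open>\<sigma> t\<close> in two ways shows
  that \<open>\<sigma> t\<close> and \<open>t\<close> pair equally with every simple root, and
  nondegeneracy concludes.\<close>

lemma homogeneous_aut_fixes_cartan:
  assumes \<sigma>: "\<sigma> \<in> carrier (homogeneous_aut_group G)" and t: "t \<in> cartan"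
  shows "\<sigma> t = t"
proof -
  have h: "lie_hom \<sigma>" and b: "bij \<sigma>" and G: "\<And>m n. \<sigma> ` G m n = G m n"
    using \<sigma> by (auto simp: mem_homogeneous_aut_group)
  have st: "\<sigma> t \<in> cartan" using G[of 0 0] t by (auto simp: G_zero)
  have "B (simple_root i) (\<sigma> t - t) = 0" for i
  proof -
    have "\<sigma> (gen_e i) \<in> root_space (simple_root i)"
      using G[of 1 "snd (deg i)"] gen_e_in_G[of i] by (auto simp: G_pos_root_space)
    then have "\<^bold>[\<sigma> t, \<sigma> (gen_e i)\<^bold>] = B (simple_root i) (\<sigma> t) *\<^sub>C \<sigma> (gen_e i)"
      using st by (simp add: root_space_def)
    moreover have "\<^bold>[\<sigma> t, \<sigma> (gen_e i)\<^bold>] = B (simple_root i) t *\<^sub>C \<sigma> (gen_e i)"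
      using t by (simp add: h bracket_cartan_e lie_hom_scale flip: lie_hom_bracket)
    moreover have "\<sigma> (gen_e i) \<noteq> 0"
      using gen_e_neq_0 b h lie_hom_zero by (metis bij_is_inj injD)
    ultimately have eq: "B (simple_root i) (\<sigma> t) = B (simple_root i) t"
      by simp
    have diff: "\<sigma> t - t \<in> cartan"
      using st t subspace_cartan by (simp add: cvec.subspace_diff)
    have "B (simple_root i) (\<sigma> t) = B (\<sigma> t - t + t) (simple_root i)"
      using st simple_root_in_cartan B_sym by simp
    also have "\<dots> = B (\<sigma> t - t) (simple_root i) + B t (simple_root i)"
      using diff t simple_root_in_cartan by (rule B_add)
    finally show ?thesis
      using eq diff t simple_root_in_cartan B_sym by simp
  qed
  then have "\<sigma> t - t = 0"
    using st t subspace_cartan by (intro cartan_nondegenerate) (simp_all add: cvec.subspace_diff)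
  then show ?thesis by simp
qed

text \<open>The coefficient of \<open>gen_e k\<close>, read off by bracketing with
  \<open>gen_f k\<close>, which kills the other \<open>gen_e\<close>. As \<open>gen_h k\<close> is
  nonzero, the scalar is unique when it exists, as it does for combinations of the
  \<open>gen_e\<close>.\<close>

definition coord :: "'i \<Rightarrow> 'g \<Rightarrow> complex" where
  "coord k x = (THE c. \<^bold>[x, gen_f k\<^bold>] = c *\<^sub>C gen_h k)"

lemma coord_sum:
  assumes "finite S" "k \<in> S"
  shows "coord k (\<Sum>i\<in>S. c i *\<^sub>C gen_e i) = c k"
  unfolding coord_def sum_gen_e_bracket_f[OF assms(1)]
  using assms(2) gen_h_neq_0[of k] by (intro the_equality) simp_all

lemma G_one_expand:
  assumes "x \<in> G 1 n"
  shows "x = (\<Sum>k\<in>roots_of_degree n. coord k x *\<^sub>C gen_e k)"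
proof -
  obtain c where c: "x = (\<Sum>k\<in>roots_of_degree n. c k *\<^sub>C gen_e k)"
    using assms span_image_coeffs[of "roots_of_degree n" x gen_e] by (auto simp: G_one)
  have "coord k x = c k" if "k \<in> roots_of_degree n" for k
    unfolding c using that by (simp add: coord_sum)
  then show ?thesis using c by (simp cong: sum.cong)
qed

lemma homogeneous_aut_gen_e:
  assumes "\<sigma> \<in> carrier (homogeneous_aut_group G)" "i \<in> roots_of_degree n"
  shows "\<sigma> (gen_e i) = (\<Sum>k\<in>roots_of_degree n. coord k (\<sigma> (gen_e i)) *\<^sub>C gen_e k)"
proof (rule G_one_expand)
  have "\<sigma> ` G 1 n = G 1 n" using assms by (simp add: mem_homogeneous_aut_group)
  then show "\<sigma> (gen_e i) \<in> G 1 n"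
    using gen_e_in_G[of i] assms(2) by (auto simp: deg_eq_iff)
qed

text \<open>Images of generators are columns, so composition becomes the matrix product in the same
  order.\<close>

lemma coord_compose:
  assumes \<sigma>: "\<sigma> \<in> carrier (homogeneous_aut_group G)"
    and \<tau>: "\<tau> \<in> carrier (homogeneous_aut_group G)"
    and i: "i \<in> roots_of_degree n" and k: "k \<in> roots_of_degree n"
  shows "coord k (\<sigma> (\<tau> (gen_e i)))
    = (\<Sum>l\<in>roots_of_degree n. coord k (\<sigma> (gen_e l)) * coord l (\<tau> (gen_e i)))"
proof -
  let ?R = "roots_of_degree n"
  have h: "lie_hom \<sigma>" using \<sigma> by (simp add: mem_homogeneous_aut_group)
  have "\<sigma> (\<tau> (gen_e i)) = (\<Sum>l\<in>?R. coord l (\<tau> (gen_e i)) *\<^sub>C \<sigma> (gen_e l))"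
    by (subst homogeneous_aut_gen_e[OF \<tau> i]) (simp add: h lie_hom_sum lie_hom_scale)
  also have "\<dots> = (\<Sum>l\<in>?R. \<Sum>k\<in>?R. (coord l (\<tau> (gen_e i)) * coord k (\<sigma> (gen_e l))) *\<^sub>C gen_e k)"
  proof (rule sum.cong[OF HOL.refl])
    fix l assume l: "l \<in> ?R"
    show "coord l (\<tau> (gen_e i)) *\<^sub>C \<sigma> (gen_e l)
      = (\<Sum>k\<in>?R. (coord l (\<tau> (gen_e i)) * coord k (\<sigma> (gen_e l))) *\<^sub>C gen_e k)"
      by (subst homogeneous_aut_gen_e[OF \<sigma> l]) (simp add: cvec.scale_sum_right scaleC_scaleC)
  qed
  also have "\<dots> = (\<Sum>k\<in>?R. (\<Sum>l\<in>?R. coord k (\<sigma> (gen_e l)) * coord l (\<tau> (gen_e i))) *\<^sub>C gen_e k)"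
    by (subst sum.swap) (simp add: cvec.scale_sum_left mult.commute)
  finally show ?thesis using k by (simp add: coord_sum)
qed

lemma coord_gen_e:
  assumes "i \<in> roots_of_degree n" "k \<in> roots_of_degree n"
  shows "coord k (gen_e i) = (if k = i then 1 else 0)"
proof -
  have "(\<Sum>l\<in>roots_of_degree n. (if l = i then 1 else 0) *\<^sub>C gen_e l)
    = (\<Sum>l\<in>roots_of_degree n. if l = i then gen_e i else 0)"
    by (intro sum.cong) (auto simp: scaleC_one)
  also have "\<dots> = gen_e i" using assms(1) by simp
  finally show ?thesis
    using coord_sum[OF finite_roots_of_degree assms(2), of "\<lambda>l. if l = i then 1 else 0"] by simp
qed

lemma homogeneous_aut_eqI:
  assumes \<sigma>: "\<sigma> \<in> carrier (homogeneous_aut_group G)"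
    and \<tau>: "\<tau> \<in> carrier (homogeneous_aut_group G)"
    and eq: "\<And>n i k. i \<in> roots_of_degree n \<Longrightarrow> k \<in> roots_of_degree n \<Longrightarrow>
      coord k (\<sigma> (gen_e i)) = coord k (\<tau> (gen_e i))"
  shows "\<sigma> = \<tau>"
proof -
  have h: "lie_hom \<sigma>" "lie_hom \<tau>"
    and G: "\<And>m n. \<sigma> ` G m n = G m n" "\<And>m n. \<tau> ` G m n = G m n"
    using \<sigma> \<tau> by (auto simp: mem_homogeneous_aut_group)
  have e: "\<sigma> (gen_e i) = \<tau> (gen_e i)" for i
  proof -
    define n where "n = snd (deg i)"
    then have i: "i \<in> roots_of_degree n" by (simp add: deg_eq_iff)
    have "(\<Sum>k\<in>roots_of_degree n. coord k (\<sigma> (gen_e i)) *\<^sub>C gen_e k)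
      = (\<Sum>k\<in>roots_of_degree n. coord k (\<tau> (gen_e i)) *\<^sub>C gen_e k)"
      using eq i by (intro sum.cong) auto
    then show ?thesis
      using homogeneous_aut_gen_e[OF \<sigma> i] homogeneous_aut_gen_e[OF \<tau> i] by metis
  qed
  have f: "\<sigma> (gen_f j) = \<tau> (gen_f j)" for j
  proof -
    define n where "n = snd (deg j)"
    define z where "z = \<sigma> (gen_f j) - \<tau> (gen_f j)"
    have "\<sigma> (gen_f j) \<in> G (-1) (- n)" "\<tau> (gen_f j) \<in> G (-1) (- n)"
      using gen_f_in_G[of j] G[of "-1" "- n"] by (auto simp: n_def)
    then have z: "z \<in> G (-1) (- n)" using G_subspace by (auto simp: z_def cvec.subspace_diff)
    have sz: "\<^bold>[\<sigma> (gen_e i), z\<^bold>] = 0" for i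
    proof -
      have "\<^bold>[gen_e i, gen_f j\<^bold>] \<in> cartan"
        using gen_h_in_cartan subspace_cartan by (auto simp: bracket_e_f cvec.subspace_0)
      then have "\<sigma> \<^bold>[gen_e i, gen_f j\<^bold>] = \<tau> \<^bold>[gen_e i, gen_f j\<^bold>]"
        using homogeneous_aut_fixes_cartan \<sigma> \<tau> by metis
      then show ?thesis
        unfolding z_def by (simp add: lie_diff_right h lie_hom_bracket e)
    qed
    \<comment> \<open>Since \<open>\<sigma>\<close> maps each space of degree \<open>(1, n)\<close>
      onto itself, every \<open>gen_e i\<close> has the form \<open>\<sigma> y\<close> with such a
      \<open>y\<close>.\<close>
    have "\<^bold>[\<sigma> y, z\<^bold>] = 0" if "y \<in> cvec.span (range gen_e)" for y
      using that by (induction rule: cvec.span_induct_alt)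
        (auto simp: h lie_hom_zero lie_hom_add lie_hom_scale lie_add_left lie_scale_left sz)
    then have "\<^bold>[gen_e i, z\<^bold>] = 0" for i
    proof -
      obtain y where y: "y \<in> G 1 (snd (deg i))" "gen_e i = \<sigma> y"
        using G(1)[of 1 "snd (deg i)"] gen_e_in_G[of i] by blast
      have "y \<in> cvec.span (range gen_e)"
        using y(1) cvec.span_mono[OF image_mono[OF subset_UNIV]] unfolding G_one by blast
      then show ?thesis
        using y(2) \<open>\<And>y. y \<in> cvec.span (range gen_e) \<Longrightarrow> \<^bold>[\<sigma> y, z\<^bold>] = 0\<close> by simp
    qed
    then have "z = 0" using f_combination_eq_0[OF z] by blast
    then show ?thesis by (simp add: z_def)
  qed
  show ?thesis using lie_hom_eqI[OF h e f] .
qed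

section \<open>Automorphisms built from invertible blocks\<close>

definition twist_e :: "('i \<Rightarrow> 'i \<Rightarrow> complex) \<Rightarrow> 'i \<Rightarrow> 'g" where
  "twist_e M i = (\<Sum>k\<in>roots_of_degree (snd (deg i)). M k i *\<^sub>C gen_e k)"

text \<open>The factors \<open>q k / q i\<close> compensate for the fact that \<open>q i *\<^sub>C gen_h i\<close>, and not \<open>gen_h i\<close>,
  depends only on the degree of \<open>i\<close>.\<close>

definition twist_f :: "('i \<Rightarrow> 'i \<Rightarrow> complex) \<Rightarrow> 'i \<Rightarrow> 'g" where
  "twist_f N i = (\<Sum>k\<in>roots_of_degree (snd (deg i)). (N i k * of_real (q k / q i)) *\<^sub>C gen_f k)"

text \<open>Families of finite matrices are encoded as functions on all pairs of roots, of which
  only the blocks of equal degree are read. The condition is one-sided; automorphisms are built from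
  both orders.\<close>

definition blocks_inverse :: "('i \<Rightarrow> 'i \<Rightarrow> complex) \<Rightarrow> ('i \<Rightarrow> 'i \<Rightarrow> complex) \<Rightarrow> bool" where
  "blocks_inverse M N \<longleftrightarrow> (\<forall>n. \<forall>i\<in>roots_of_degree n. \<forall>j\<in>roots_of_degree n.
     (\<Sum>k\<in>roots_of_degree n. M i k * N k j) = (if i = j then 1 else 0))"

lemma bracket_cartan_twist_e:
  assumes "t \<in> cartan"
  shows "\<^bold>[t, twist_e M i\<^bold>] = B (simple_root i) t *\<^sub>C twist_e M i"
  unfolding twist_e_def lie_sum_right cvec.scale_sum_right
proof (rule sum.cong[OF HOL.refl])
  fix k assume "k \<in> roots_of_degree (snd (deg i))"
  then have "simple_root k = simple_root i" by (intro simple_root_eq) (simp add: deg_eq_iff)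
  then show "\<^bold>[t, M k i *\<^sub>C gen_e k\<^bold>] = B (simple_root i) t *\<^sub>C M k i *\<^sub>C gen_e k"
    using assms by (simp add: lie_scale_right bracket_cartan_e scaleC_scaleC mult.commute)
qed

lemma bracket_cartan_twist_f:
  assumes "t \<in> cartan"
  shows "\<^bold>[t, twist_f N i\<^bold>] = - B (simple_root i) t *\<^sub>C twist_f N i"
  unfolding twist_f_def lie_sum_right cvec.scale_sum_right
proof (rule sum.cong[OF HOL.refl])
  fix k assume "k \<in> roots_of_degree (snd (deg i))"
  then have "simple_root k = simple_root i" by (intro simple_root_eq) (simp add: deg_eq_iff)
  then show "\<^bold>[t, (N i k * of_real (q k / q i)) *\<^sub>C gen_f k\<^bold>]
    = - B (simple_root i) t *\<^sub>C (N i k * of_real (q k / q i)) *\<^sub>C gen_f k"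
    using assms
    by (simp add: lie_scale_right bracket_cartan_f scaleC_scaleC mult.commute del: of_real_divide)
qed

lemma B_simple_root_gen_h: "B (simple_root k) (gen_h i) = complex_of_real (A i k)"
proof -
  have "B (simple_root k) (gen_h i) = B (gen_h i) (simple_root k)"
    by (rule B_sym) (rule simple_root_in_cartan gen_h_in_cartan)+
  also have "\<dots> = complex_of_real (1 / q i) * complex_of_real (q i * A i k)"
    using B_scale[of "simple_root i" "simple_root k"] by (simp add: gen_h_eq simple_root_in_cartan B_simple_root)
  finally show ?thesis using q_pos[of i] by simp
qed

text \<open>In equal degrees the bracket collapses to \<open>gen_h j\<close> times the
  \<open>(j, i)\<close> entry of the product of \<open>N\<close> and \<open>M\<close>; in different
  degrees the two sums share no root.\<close>

lemma bracket_twist_e_f: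
  assumes NM: "blocks_inverse N M"
  shows "\<^bold>[twist_e M i, twist_f N j\<^bold>] = (if i = j then gen_h i else 0)"
proof -
  let ?R = "\<lambda>i. roots_of_degree (snd (deg i))"
  have expand: "\<^bold>[twist_e M i, twist_f N j\<^bold>] = (\<Sum>l\<in>?R j. (N j l * of_real (q l / q j)) *\<^sub>C
      (if l \<in> ?R i then M l i *\<^sub>C gen_h l else 0))"
    unfolding twist_f_def twist_e_def
    by (simp add: lie_sum_right[of "sum _ _"] lie_scale_right sum_gen_e_bracket_f)
  show ?thesis
  proof (cases "snd (deg i) = snd (deg j)")
    case False
    then have "i \<noteq> j" by auto
    moreover have "l \<notin> ?R i" if "l \<in> ?R j" for l
      using that False by (simp add: deg_eq_iff)
    ultimately show ?thesis unfolding expand by simp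
  next
    case True
    have "\<^bold>[twist_e M i, twist_f N j\<^bold>] = (\<Sum>l\<in>?R j. (N j l * M l i) *\<^sub>C gen_h j)"
      unfolding expand
    proof (rule sum.cong[OF HOL.refl])
      fix l assume l: "l \<in> ?R j"
      have root: "simple_root l = simple_root j"
        using l by (intro simple_root_eq) (simp add: deg_eq_iff)
      have "complex_of_real (q j / q l) * complex_of_real (1 / q j) = complex_of_real (1 / q l)"
        using q_pos[of j] by simp
      \<comment> \<open>Roots of one degree have the same simple root, so their \<open>gen_h\<close>
        differ by a ratio of symmetrizer entries. It cancels the factor built into
        \<open>twist_f\<close>.\<close>
      then have h: "gen_h l = complex_of_real (q j / q l) *\<^sub>C gen_h j"
        by (simp only: gen_h_eq[of l] gen_h_eq[of j] scaleC_scaleC root)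
      have "N j l * complex_of_real (q l / q j) * (M l i * complex_of_real (q j / q l)) = N j l * M l i"
        using q_pos[of j] q_pos[of l] by (simp add: field_simps)
      moreover have "l \<in> ?R i" using l True by simp
      ultimately show "(N j l * of_real (q l / q j)) *\<^sub>C (if l \<in> ?R i then M l i *\<^sub>C gen_h l else 0)
        = (N j l * M l i) *\<^sub>C gen_h j"
        by (simp only: h if_True scaleC_scaleC)
    qed
    also have "\<dots> = (\<Sum>l\<in>?R j. N j l * M l i) *\<^sub>C gen_h j"
      by (simp add: cvec.scale_sum_left)
    also have "\<dots> = (if i = j then gen_h i else 0)"
      using NM True unfolding blocks_inverse_def
      by (auto simp: deg_eq_iff scaleC_one)
    finally show ?thesis .
  qed
qed

lemma bracket_twist_e_e:
  assumes "A i j = 0"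
  shows "\<^bold>[twist_e M i, twist_e M j\<^bold>] = 0"
proof -
  have "\<^bold>[gen_e k, gen_e l\<^bold>] = 0"
    if "k \<in> roots_of_degree (snd (deg i))" "l \<in> roots_of_degree (snd (deg j))" for k l
    using that assms cartan_matrix_entry_eq_0[of i k j l] by (intro bracket_e_e) (simp add: deg_eq_iff)
  then show ?thesis
    by (simp add: twist_e_def lie_sum_left lie_sum_right lie_scale_left lie_scale_right)
qed

lemma bracket_twist_f_f:
  assumes "A i j = 0"
  shows "\<^bold>[twist_f N i, twist_f N j\<^bold>] = 0"
proof -
  have "\<^bold>[gen_f k, gen_f l\<^bold>] = 0"
    if "k \<in> roots_of_degree (snd (deg i))" "l \<in> roots_of_degree (snd (deg j))" for k l
    using that assms cartan_matrix_entry_eq_0[of i k j l] by (intro bracket_f_f) (simp add: deg_eq_iff)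
  then show ?thesis
    by (simp add: twist_f_def lie_sum_left lie_sum_right lie_scale_left lie_scale_right)
qed

text \<open>The real root is alone in its degree, so its generators are only rescaled. All roots in
  the degree of \<open>j\<close> have the same entry in row \<open>i\<close>, so one exponent serves
  every summand.\<close>

lemma
  assumes "0 < A i i" "i \<noteq> j"
  shows serre_twist_e: "(lie_bracket (twist_e M i) ^^ nat \<lfloor>1 - A i j\<rfloor>) (twist_e M j) = 0"
    and serre_twist_f: "(lie_bracket (twist_f N i) ^^ nat \<lfloor>1 - A i j\<rfloor>) (twist_f N j) = 0"
proof -
  note Ri = roots_of_degree_real[OF assms(1)]
  have *: "A i l = A i j \<and> i \<noteq> l" if "l \<in> roots_of_degree (snd (deg j))" for l
    using that cartan_matrix_entry_eq[of l j i] assms(2) Ri by (auto simp: deg_eq_iff set_eq_iff)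
  have "twist_e M i = M i i *\<^sub>C gen_e i"
    by (simp add: twist_e_def Ri)
  then show "(lie_bracket (twist_e M i) ^^ nat \<lfloor>1 - A i j\<rfloor>) (twist_e M j) = 0"
    unfolding twist_e_def[of M j]
    using * serre_gen_e[OF assms(1)]
    by (simp only:) (rule funpow_lie_bracket_scaled_sum_eq_0, force)
  have "twist_f N i = N i i *\<^sub>C gen_f i"
    using q_pos[of i] by (simp add: twist_f_def Ri)
  then show "(lie_bracket (twist_f N i) ^^ nat \<lfloor>1 - A i j\<rfloor>) (twist_f N j) = 0"
    unfolding twist_f_def[of N j]
    using * serre_gen_f[OF assms(1)]
    by (simp only:) (rule funpow_lie_bracket_scaled_sum_eq_0, force)
qed

definition twist_free :: "('i \<Rightarrow> 'i \<Rightarrow> complex) \<Rightarrow> ('i \<Rightarrow> 'i \<Rightarrow> complex) \<Rightarrow> 'i bkm_gen free_lie \<Rightarrow> 'g"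
  where "twist_free M N = free_lie_extend (case_bkm_gen gen_h (twist_e M) (twist_f N))"

lemma lie_hom_twist_free: "lie_hom (twist_free M N)"
  by (simp add: twist_free_def lie_hom_free_lie_extend)

lemma twist_free_gen [simp]:
  "twist_free M N (free_h i) = gen_h i"
  "twist_free M N (free_e i) = twist_e M i"
  "twist_free M N (free_f i) = twist_f N i"
  by (simp_all add: twist_free_def)

lemma twist_free_ideal:
  assumes "blocks_inverse N M" "x \<in> bkm_ideal A"
  shows "twist_free M N x = 0"
  using lie_hom_twist_free _ assms(2)[unfolded bkm_ideal_def]
proof (rule lie_hom_kills_ideal_generated)
  fix x assume "x \<in> bkm_relators A"
  then show "twist_free M N x = 0"
    by cases
      (simp_all add: lie_hom_twist_free lie_hom_diff lie_hom_add lie_hom_bracket lie_hom_scale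
        lie_hom_funpow bracket_twist_e_f[OF assms(1)] bracket_twist_e_e bracket_twist_f_f
        serre_twist_e serre_twist_f bracket_cartan_twist_e bracket_cartan_twist_f gen_h_in_cartan
        B_simple_root_gen_h)
qed

text \<open>The image of a central element of \<open>\<gg>(A)\<close> commutes with \<open>gen_h\<close> and the twisted generators,
  and no nonzero element of the Cartan subalgebra does, the form being nondegenerate there.\<close>

lemma twist_free_kernel:
  assumes NM: "blocks_inverse N M" and x: "\<pi> x = 0"
  shows "twist_free M N x = 0"
proof -
  let ?z = "twist_free M N x"
  have comm: "\<^bold>[?z, twist_free M N y\<^bold>] = 0" for y
    using twist_free_ideal[OF NM central[OF x, of y]]
    by (simp add: lie_hom_twist_free lie_hom_bracket)
  have "\<^bold>[?z, t\<^bold>] = 0" if "t \<in> cartan" for t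
    using lie_span_right[of t "range gen_h" ?z "{0}"] that comm[of "free_h _"]
    by (auto simp: cartan_eq_span_h)
  then have "\<^bold>[t, ?z\<^bold>] = 0" if "t \<in> cartan" for t
    using that lie_swap[of t ?z] by simp
  \<comment> \<open>Commuting with the Cartan subalgebra places the image in the zero weight space,
    which is the piece of degree \<open>(0, 0)\<close>, the Cartan subalgebra itself.\<close>
  then have "?z \<in> root_space 0"
    by (simp add: root_space_def B_zero_left)
  moreover have "G 0 0 = root_space 0"
    by (rule grading_basis) simp
  ultimately have z: "?z \<in> cartan" by (simp add: G_zero)
  then show ?thesis
  proof (rule cartan_nondegenerate)
    fix i
    have "twist_e M i \<noteq> 0"
      using bracket_twist_e_f[OF NM, of i i] gen_h_neq_0[of i] by auto
    then show "B (simple_root i) ?z = 0"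
      using comm[of "free_e i"] bracket_cartan_twist_e[OF z, of M i] by simp
  qed
qed

text \<open>The preimage under \<open>\<pi>\<close> is arbitrary; \<open>twist_free_kernel\<close>
  makes the value independent of it when \<open>blocks_inverse N M\<close> holds.\<close>

definition twist :: "('i \<Rightarrow> 'i \<Rightarrow> complex) \<Rightarrow> ('i \<Rightarrow> 'i \<Rightarrow> complex) \<Rightarrow> 'g \<Rightarrow> 'g" where
  "twist M N y = twist_free M N (inv_into UNIV \<pi> y)"

lemma twist_\<pi>:
  assumes "blocks_inverse N M"
  shows "twist M N (\<pi> x) = twist_free M N x"
proof -
  have "\<pi> (inv_into UNIV \<pi> (\<pi> x) - x) = 0"
    using range_\<pi> by (simp add: hom lie_hom_diff surj_f_inv_f)
  from twist_free_kernel[OF assms this] show ?thesis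
    by (simp add: twist_def lie_hom_diff lie_hom_twist_free)
qed

lemma lie_hom_twist:
  assumes NM: "blocks_inverse N M"
  shows "lie_hom (twist M N)"
proof (rule lie_homI)
  note hom' = lie_hom_twist_free[of M N]
  have s: "\<exists>a. x = \<pi> a" for x using range_\<pi> by blast
  fix x y c
  obtain a b where x: "x = \<pi> a" and y: "y = \<pi> b" using s[of x] s[of y] by blast
  show "twist M N (x + y) = twist M N x + twist M N y"
    by (simp only: x y lie_hom_add[OF hom, symmetric] twist_\<pi>[OF NM] lie_hom_add[OF hom'])
  show "twist M N (c *\<^sub>C x) = c *\<^sub>C twist M N x"
    by (simp only: x lie_hom_scale[OF hom, symmetric] twist_\<pi>[OF NM] lie_hom_scale[OF hom'])
  show "twist M N \<^bold>[x, y\<^bold>] = \<^bold>[twist M N x, twist M N y\<^bold>]"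
    by (simp only: x y lie_hom_bracket[OF hom, symmetric] twist_\<pi>[OF NM] lie_hom_bracket[OF hom'])
qed

lemma twist_gen:
  assumes "blocks_inverse N M"
  shows "twist M N (gen_h i) = gen_h i" "twist M N (gen_e i) = twist_e M i"
    "twist M N (gen_f i) = twist_f N i"
  unfolding gen_h_def[of i] gen_e_def[of i] gen_f_def[of i]
  by (simp_all add: twist_\<pi>[OF assms] gen_h_def)

text \<open>After exchanging the sums, the first identity reads column \<open>i\<close> of the
  product of \<open>M\<close> and \<open>N\<close>, the second row \<open>i\<close>. They serve
  \<open>gen_e\<close> and the rescaled \<open>gen_f\<close> respectively.\<close>

lemma double_block_sum:
  fixes g :: "'i \<Rightarrow> 'g"
  assumes MN: "blocks_inverse M N" and i: "i \<in> roots_of_degree n"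
  shows "(\<Sum>k\<in>roots_of_degree n. N k i *\<^sub>C (\<Sum>l\<in>roots_of_degree n. M l k *\<^sub>C g l)) = g i"
    and "(\<Sum>k\<in>roots_of_degree n. M i k *\<^sub>C (\<Sum>l\<in>roots_of_degree n. N k l *\<^sub>C g l)) = g i"
proof -
  let ?R = "roots_of_degree n"
  have "(\<Sum>k\<in>?R. N k i *\<^sub>C (\<Sum>l\<in>?R. M l k *\<^sub>C g l)) = (\<Sum>l\<in>?R. (\<Sum>k\<in>?R. M l k * N k i) *\<^sub>C g l)"
    by (simp add: cvec.scale_sum_right cvec.scale_sum_left scaleC_scaleC mult.commute)
      (rule sum.swap)
  also have "\<dots> = (\<Sum>l\<in>?R. if l = i then g i else 0)"
    using MN i by (intro sum.cong) (auto simp: blocks_inverse_def scaleC_one)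
  finally show "(\<Sum>k\<in>?R. N k i *\<^sub>C (\<Sum>l\<in>?R. M l k *\<^sub>C g l)) = g i" using i by simp
  have "(\<Sum>k\<in>?R. M i k *\<^sub>C (\<Sum>l\<in>?R. N k l *\<^sub>C g l)) = (\<Sum>l\<in>?R. (\<Sum>k\<in>?R. M i k * N k l) *\<^sub>C g l)"
    by (simp add: cvec.scale_sum_right cvec.scale_sum_left scaleC_scaleC) (rule sum.swap)
  also have "\<dots> = (\<Sum>l\<in>?R. if l = i then g i else 0)"
    using MN i by (intro sum.cong) (auto simp: blocks_inverse_def scaleC_one)
  finally show "(\<Sum>k\<in>?R. M i k *\<^sub>C (\<Sum>l\<in>?R. N k l *\<^sub>C g l)) = g i" using i by simp
qed

lemma twist_twist:
  assumes MN: "blocks_inverse M N" and NM: "blocks_inverse N M"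
  shows "twist M N (twist N M x) = x"
proof -
  have "twist M N \<circ> twist N M = id"
  proof (rule lie_hom_eqI)
    show "lie_hom (twist M N \<circ> twist N M)"
      by (rule lie_homI)
        (simp_all add: lie_hom_twist MN NM lie_hom_add lie_hom_scale lie_hom_bracket)
    show "lie_hom (id :: 'g \<Rightarrow> 'g)" by (rule lie_homI) simp_all
    fix i
    define n where "n = snd (deg i)"
    have R: "roots_of_degree (snd (deg k)) = roots_of_degree n" if "k \<in> roots_of_degree n" for k
      using that by (simp add: deg_eq_iff)
    have i: "i \<in> roots_of_degree n" by (simp add: n_def deg_eq_iff)
    have "(twist M N \<circ> twist N M) (gen_e i) = (\<Sum>k\<in>roots_of_degree n. N k i *\<^sub>C twist_e M k)"
      by (simp add: twist_gen MN NM twist_e_def[of N] lie_hom_twist lie_hom_sum lie_hom_scale n_def)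
    also have "\<dots> = (\<Sum>k\<in>roots_of_degree n. N k i *\<^sub>C (\<Sum>l\<in>roots_of_degree n. M l k *\<^sub>C gen_e l))"
      by (simp add: twist_e_def R)
    also have "\<dots> = gen_e i" by (rule double_block_sum[OF MN i])
    finally show "(twist M N \<circ> twist N M) (gen_e i) = id (gen_e i)" by simp
    have "(twist M N \<circ> twist N M) (gen_f i)
      = (\<Sum>k\<in>roots_of_degree n. (M i k * of_real (q k / q i)) *\<^sub>C twist_f N k)"
      by (simp add: twist_gen MN NM twist_f_def[of M] lie_hom_twist lie_hom_sum lie_hom_scale n_def)
    \<comment> \<open>The scale factors \<open>q k / q i\<close> and \<open>q l / q k\<close>
      telescope to \<open>q l / q i\<close>, which is absorbed into the vectors before the block
      identity is applied.\<close>
    also have "\<dots> = (\<Sum>k\<in>roots_of_degree n. M i k *\<^sub>C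
        (\<Sum>l\<in>roots_of_degree n. N k l *\<^sub>C (of_real (q l / q i) *\<^sub>C gen_f l)))"
    proof (rule sum.cong[OF HOL.refl])
      fix k assume "k \<in> roots_of_degree n"
      then show "(M i k * of_real (q k / q i)) *\<^sub>C twist_f N k = M i k *\<^sub>C
          (\<Sum>l\<in>roots_of_degree n. N k l *\<^sub>C (of_real (q l / q i) *\<^sub>C gen_f l))"
        using q_pos[of k] by (simp add: twist_f_def R cvec.scale_sum_right scaleC_scaleC mult.assoc)
    qed
    also have "\<dots> = of_real (q i / q i) *\<^sub>C gen_f i" by (rule double_block_sum[OF MN i])
    finally show "(twist M N \<circ> twist N M) (gen_f i) = id (gen_f i)"
      using q_pos[of i] by (simp add: scaleC_one)
  qed
  then show ?thesis by (metis comp_apply id_apply)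
qed

text \<open>Every graded piece is a root space, and the twist fixes the Cartan subalgebra pointwise,
  so it preserves weights.\<close>

lemma twist_G:
  assumes NM: "blocks_inverse N M" and x: "x \<in> G m n"
  shows "twist M N x \<in> G m n"
proof -
  obtain r where r: "r \<in> cartan" "G m n = root_space r" by (rule G_root_space)
  have t: "twist M N t = t" if "t \<in> cartan" for t
    using that unfolding cartan_eq_span_h
    by (induction rule: cvec.span_induct_alt)
      (auto simp: lie_hom_twist[OF NM] lie_hom_zero lie_hom_add lie_hom_scale twist_gen[OF NM])
  have "\<^bold>[t, twist M N x\<^bold>] = B r t *\<^sub>C twist M N x" if "t \<in> cartan" for t
    using x that t[OF that] lie_hom_bracket[OF lie_hom_twist[OF NM], of t x]
    by (simp add: r root_space_def lie_hom_scale lie_hom_twist NM)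
  then show ?thesis by (simp add: r root_space_def)
qed

lemma twist_homogeneous_aut:
  assumes MN: "blocks_inverse M N" and NM: "blocks_inverse N M"
  shows "twist M N \<in> carrier (homogeneous_aut_group G)"
proof -
  have "bij (twist M N)"
  proof (rule o_bij)
    show "twist N M \<circ> twist M N = id" "twist M N \<circ> twist N M = id"
      using twist_twist[OF NM MN] twist_twist[OF MN NM] by (simp_all add: fun_eq_iff)
  qed
  moreover have "twist M N ` G m n = G m n" for m n
  proof
    show "G m n \<subseteq> twist M N ` G m n"
    proof
      fix x assume "x \<in> G m n"
      from twist_G[OF MN this] show "x \<in> twist M N ` G m n"
        by (rule image_eqI[rotated]) (simp add: twist_twist[OF MN NM])
    qed
  qed (use twist_G[OF NM] in blast)
  ultimately show ?thesis
    using lie_hom_twist[OF NM] by (simp add: mem_homogeneous_aut_group)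
qed

lemma coord_twist:
  assumes "blocks_inverse N M" "i \<in> roots_of_degree n" "k \<in> roots_of_degree n"
  shows "coord k (twist M N (gen_e i)) = M k i"
  using assms by (simp add: twist_gen twist_e_def deg_eq_iff coord_sum)

section \<open>Matrices of homogeneous automorphisms\<close>

definition root_enum :: "int \<Rightarrow> nat \<Rightarrow> 'i" where
  "root_enum n = (SOME h. bij_betw h {0..<card (roots_of_degree n)} (roots_of_degree n))"

definition root_index :: "'i \<Rightarrow> nat" where
  "root_index i = the_inv_into {0..<card (roots_of_degree (snd (deg i)))} (root_enum (snd (deg i))) i"

lemma simple_root_mult_eq: "simple_root_mult deg n = card (roots_of_degree n)"
  by (simp add: simple_root_mult_def roots_of_degree_def)

lemma bij_betw_root_enum:
  "bij_betw (root_enum n) {0..<simple_root_mult deg n} (roots_of_degree n)"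
  using someI_ex[OF ex_bij_betw_nat_finite[OF finite_roots_of_degree[of n]]]
  by (simp only: root_enum_def simple_root_mult_eq)

lemma root_enum_in: "a < simple_root_mult deg n \<Longrightarrow> root_enum n a \<in> roots_of_degree n"
  using bij_betw_root_enum[of n] by (auto simp: bij_betw_def)

lemma root_index_enum:
  assumes "a < simple_root_mult deg n"
  shows "root_index (root_enum n a) = a"
proof -
  have "snd (deg (root_enum n a)) = n" using root_enum_in[OF assms] by (simp add: deg_eq_iff)
  then show ?thesis
    using the_inv_into_f_f[OF bij_betw_imp_inj_on[OF bij_betw_root_enum], of a n] assms
    by (simp add: root_index_def simple_root_mult_eq)
qed

lemma root_index:
  assumes "i \<in> roots_of_degree n"
  shows "root_index i < simple_root_mult deg n" "root_enum n (root_index i) = i"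
proof -
  have "i \<in> root_enum n ` {0..<simple_root_mult deg n}"
    using assms by (simp only: bij_betw_imp_surj_on[OF bij_betw_root_enum])
  then obtain a where "a < simple_root_mult deg n" "i = root_enum n a" by auto
  then show "root_index i < simple_root_mult deg n" "root_enum n (root_index i) = i"
    by (simp_all add: root_index_enum)
qed

lemma sum_roots_of_degree:
  "(\<Sum>k\<in>roots_of_degree n. g k) = (\<Sum>a = 0..<simple_root_mult deg n. g (root_enum n a))"
  using sum.reindex_bij_betw[OF bij_betw_root_enum, of g n] by simp

definition aut_matrix :: "('g \<Rightarrow> 'g) \<Rightarrow> int \<Rightarrow> complex mat" where
  "aut_matrix \<sigma> n = mat (simple_root_mult deg n) (simple_root_mult deg n)
     (\<lambda>(a, b). coord (root_enum n a) (\<sigma> (gen_e (root_enum n b))))"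

lemma aut_matrix_carrier: "aut_matrix \<sigma> n \<in> carrier_mat (simple_root_mult deg n) (simple_root_mult deg n)"
  by (simp add: aut_matrix_def)

lemma aut_matrix_compose:
  assumes "\<sigma> \<in> carrier (homogeneous_aut_group G)" "\<tau> \<in> carrier (homogeneous_aut_group G)"
  shows "aut_matrix (\<sigma> \<circ> \<tau>) n = aut_matrix \<sigma> n * aut_matrix \<tau> n"
  by (rule eq_matI)
    (simp_all add: aut_matrix_def scalar_prod_def coord_compose[OF assms root_enum_in root_enum_in]
      sum_roots_of_degree)

lemma aut_matrix_id: "aut_matrix id n = 1\<^sub>m (simple_root_mult deg n)"
  by (rule eq_matI) (auto simp: aut_matrix_def coord_gen_e[OF root_enum_in root_enum_in]
      dest: arg_cong[of _ _ root_index] simp: root_index_enum)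

text \<open>The matrix of the inverse automorphism is a two-sided inverse.\<close>

lemma aut_matrix_GL:
  assumes \<sigma>: "\<sigma> \<in> carrier (homogeneous_aut_group G)"
  shows "aut_matrix \<sigma> n \<in> carrier (general_linear_group (simple_root_mult deg n))"
proof -
  have "bij \<sigma>" using \<sigma> by (simp add: mem_homogeneous_aut_group)
  then have "inv_into UNIV \<sigma> \<circ> \<sigma> = id" "\<sigma> \<circ> inv_into UNIV \<sigma> = id"
    by (simp_all add: bij_is_inj bij_is_surj surj_iff[symmetric])
  then show ?thesis
    using aut_matrix_compose[OF homogeneous_aut_inv[OF \<sigma>] \<sigma>, of n]
      aut_matrix_compose[OF \<sigma> homogeneous_aut_inv[OF \<sigma>], of n]
    by (auto simp: mem_general_linear_group aut_matrix_carrier aut_matrix_id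
        intro!: bexI[of _ "aut_matrix (inv_into UNIV \<sigma>) n"])
qed

lemma aut_matrix_inj:
  assumes \<sigma>: "\<sigma> \<in> carrier (homogeneous_aut_group G)"
    and \<tau>: "\<tau> \<in> carrier (homogeneous_aut_group G)"
    and eq: "\<And>n. n \<ge> -1 \<Longrightarrow> aut_matrix \<sigma> n = aut_matrix \<tau> n"
  shows "\<sigma> = \<tau>"
proof (rule homogeneous_aut_eqI[OF \<sigma> \<tau>])
  fix n i k assume i: "i \<in> roots_of_degree n" and k: "k \<in> roots_of_degree n"
  \<comment> \<open>No simple root has second degree below -1, so comparing matrices from -1 on
    misses nothing.\<close>
  have "n \<ge> -1" using i snd_deg_ge[of i] by (simp add: deg_eq_iff)
  then have "aut_matrix \<sigma> n $$ (root_index k, root_index i)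
    = aut_matrix \<tau> n $$ (root_index k, root_index i)" by (simp add: eq)
  then show "coord k (\<sigma> (gen_e i)) = coord k (\<tau> (gen_e i))"
    by (simp add: aut_matrix_def root_index[OF i] root_index[OF k])
qed

lemma blocks_inverse_matrices:
  fixes X Y :: "int \<Rightarrow> complex mat"
  assumes X: "\<And>n. n \<ge> -1 \<Longrightarrow> X n \<in> carrier_mat (simple_root_mult deg n) (simple_root_mult deg n)"
    and Y: "\<And>n. n \<ge> -1 \<Longrightarrow> Y n \<in> carrier_mat (simple_root_mult deg n) (simple_root_mult deg n)"
    and XY: "\<And>n. n \<ge> -1 \<Longrightarrow> X n * Y n = 1\<^sub>m (simple_root_mult deg n)"
  shows "blocks_inverse (\<lambda>k i. X (snd (deg i)) $$ (root_index k, root_index i))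
    (\<lambda>k i. Y (snd (deg i)) $$ (root_index k, root_index i))"
  unfolding blocks_inverse_def
proof (intro allI ballI)
  fix n i j assume i: "i \<in> roots_of_degree n" and j: "j \<in> roots_of_degree n"
  let ?c = "simple_root_mult deg n"
  have n: "n \<ge> -1" using i snd_deg_ge[of i] by (simp add: deg_eq_iff)
  have "(\<Sum>k\<in>roots_of_degree n. X (snd (deg k)) $$ (root_index i, root_index k) *
      Y (snd (deg j)) $$ (root_index k, root_index j))
    = (\<Sum>k\<in>roots_of_degree n. X n $$ (root_index i, root_index k) * Y n $$ (root_index k, root_index j))"
    using j by (intro sum.cong) (auto simp: deg_eq_iff)
  also have "\<dots> = (\<Sum>a = 0..<?c. X n $$ (root_index i, a) * Y n $$ (a, root_index j))"
    by (simp add: sum_roots_of_degree root_index_enum)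
  also have "\<dots> = (X n * Y n) $$ (root_index i, root_index j)"
    using X[OF n] Y[OF n] root_index(1)[OF i] root_index(1)[OF j] by (simp add: scalar_prod_def)
  also have "\<dots> = (if root_index i = root_index j then 1 else 0)"
    using root_index(1)[OF i] root_index(1)[OF j] by (simp add: XY[OF n])
  also have "\<dots> = (if i = j then 1 else 0)"
    using root_index(2)[OF i] root_index(2)[OF j] by metis
  finally show "(\<Sum>k\<in>roots_of_degree n. X (snd (deg k)) $$ (root_index i, root_index k) *
      Y (snd (deg j)) $$ (root_index k, root_index j)) = (if i = j then 1 else 0)" .
qed

lemma aut_matrix_surj:
  assumes X: "\<And>n. n \<ge> -1 \<Longrightarrow> X n \<in> carrier (general_linear_group (simple_root_mult deg n))"
  obtains \<sigma> where "\<sigma> \<in> carrier (homogeneous_aut_group G)"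
    and "\<And>n. n \<ge> -1 \<Longrightarrow> aut_matrix \<sigma> n = X n"
proof -
  let ?c = "simple_root_mult deg"
  \<comment> \<open>The bound sits inside the existential, so that choice gives a function
    \<open>Y\<close> on all integers.\<close>
  have "\<forall>n. \<exists>Y. n \<ge> -1 \<longrightarrow> Y \<in> carrier_mat (?c n) (?c n) \<and> Y * X n = 1\<^sub>m (?c n) \<and> X n * Y = 1\<^sub>m (?c n)"
    using X by (meson mem_general_linear_group)
  then obtain Y where Y: "\<And>n. n \<ge> -1 \<Longrightarrow> Y n \<in> carrier_mat (?c n) (?c n)"
    "\<And>n. n \<ge> -1 \<Longrightarrow> Y n * X n = 1\<^sub>m (?c n)" "\<And>n. n \<ge> -1 \<Longrightarrow> X n * Y n = 1\<^sub>m (?c n)"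
    by metis
  have Xc: "X n \<in> carrier_mat (?c n) (?c n)" if "n \<ge> -1" for n
    using X[OF that] by (simp add: mem_general_linear_group)
  \<comment> \<open>For roots of different degree the index may lie outside the matrix; such entries
    are never read.\<close>
  define M where "M k i = X (snd (deg i)) $$ (root_index k, root_index i)" for k i
  define N where "N k i = Y (snd (deg i)) $$ (root_index k, root_index i)" for k i
  have MN: "blocks_inverse M N"
    unfolding M_def N_def using Xc Y by (intro blocks_inverse_matrices)
  have NM: "blocks_inverse N M"
    unfolding M_def N_def using Xc Y by (intro blocks_inverse_matrices)
  have "aut_matrix (twist M N) n = X n" if n: "n \<ge> -1" for n
  proof (rule eq_matI)
    show "aut_matrix (twist M N) n $$ (a, b) = X n $$ (a, b)"
      if "a < dim_row (X n)" "b < dim_col (X n)" for a b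
    proof -
      have ab: "a < ?c n" "b < ?c n" using that Xc[OF n] by auto
      then show ?thesis
        using root_enum_in[OF ab(2)]
        by (simp add: aut_matrix_def coord_twist[OF NM root_enum_in root_enum_in] M_def
            root_index_enum deg_eq_iff)
    qed
  qed (use Xc[OF n] in \<open>auto simp: aut_matrix_def\<close>)
  then show thesis using that twist_homogeneous_aut[OF MN NM] by blast
qed

text \<open>Elements of the product group are extensional functions on \<open>{-1..}\<close>, which
  is why the family of matrices is restricted to that set.\<close>

lemma homogeneous_aut_group_iso:
  "(\<lambda>\<sigma>. \<lambda>n\<in>{-1..}. aut_matrix \<sigma> n) \<in> iso (homogeneous_aut_group G)
    (product_group {-1..} (\<lambda>n. general_linear_group (simple_root_mult deg n)))"
    (is "?\<Phi> \<in> iso ?A ?P")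
proof -
  have car: "?\<Phi> \<sigma> \<in> carrier ?P" if "\<sigma> \<in> carrier ?A" for \<sigma>
    using aut_matrix_GL[OF that] by auto
  moreover have "?\<Phi> (\<sigma> \<otimes>\<^bsub>?A\<^esub> \<tau>) = ?\<Phi> \<sigma> \<otimes>\<^bsub>?P\<^esub> ?\<Phi> \<tau>"
    if "\<sigma> \<in> carrier ?A" "\<tau> \<in> carrier ?A" for \<sigma> \<tau>
  proof -
    have "\<sigma> \<otimes>\<^bsub>?A\<^esub> \<tau> = \<sigma> \<circ> \<tau>" by (simp add: homogeneous_aut_group_def)
    moreover have "X \<otimes>\<^bsub>general_linear_group n\<^esub> Y = X * Y" for X Y and n
      by (simp add: general_linear_group_def units_of_def ring_mat_def)
    ultimately show ?thesis
      using aut_matrix_compose[OF that] by (auto simp: restrict_def)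
  qed
  moreover have "inj_on ?\<Phi> (carrier ?A)"
  proof (rule inj_onI)
    fix \<sigma> \<tau> assume \<sigma>: "\<sigma> \<in> carrier ?A" and \<tau>: "\<tau> \<in> carrier ?A" and "?\<Phi> \<sigma> = ?\<Phi> \<tau>"
    then have "aut_matrix \<sigma> n = aut_matrix \<tau> n" if "n \<ge> -1" for n
      using that by (metis atLeast_iff restrict_apply')
    then show "\<sigma> = \<tau>" by (rule aut_matrix_inj[OF \<sigma> \<tau>])
  qed
  moreover have "carrier ?P \<subseteq> ?\<Phi> ` carrier ?A"
  proof
    fix X assume X: "X \<in> carrier ?P"
    then have "X n \<in> carrier (general_linear_group (simple_root_mult deg n))" if "n \<ge> -1" for n
      using that by auto
    then obtain \<sigma> where \<sigma>: "\<sigma> \<in> carrier ?A" "\<And>n. n \<ge> -1 \<Longrightarrow> aut_matrix \<sigma> n = X n"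
      using aut_matrix_surj by blast
    have "?\<Phi> \<sigma> = X" using X \<sigma>(2) by (auto simp: PiE_def extensional_def)
    then show "X \<in> ?\<Phi> ` carrier ?A" using \<sigma>(1) by blast
  qed
  ultimately show ?thesis
    unfolding iso_def hom_def bij_betw_def by blast
qed

end

theorem lemma6p1:
  fixes A :: "'i::countable \<Rightarrow> 'i \<Rightarrow> real"
    and \<pi> :: "'i bkm_gen free_lie \<Rightarrow> 'g::complex_lie_algebra"
    and D :: "'g set"
    and q :: "'i \<Rightarrow> real"
    and B :: "'g \<Rightarrow> 'g \<Rightarrow> complex"
    and G :: "int \<Rightarrow> int \<Rightarrow> 'g set"
    and deg :: "'i \<Rightarrow> int \<times> int"
    and N :: int
    and V :: "int \<Rightarrow> int \<Rightarrow> int \<Rightarrow> 'v::complex_vector set"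
    and \<phi> :: "int \<Rightarrow> int \<Rightarrow> 'g \<Rightarrow> 'v"
  assumes "graded_fricke_lie_algebra A \<pi> D q B G deg"
    and "N \<ge> 1"
    and "q_compatibility_groupoid N G V \<phi>"
  shows "homogeneous_aut_group G \<cong>
    product_group {-1..} (\<lambda>n. general_linear_group (simple_root_mult deg n))"
proof -
  interpret graded_fricke_lie_algebra A \<pi> D q B G deg by (rule assms(1))
  show ?thesis unfolding is_iso_def using homogeneous_aut_group_iso by blast
qed

end
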